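(* Let $W:\mathcal{X}\to\mathcal{Y}$ be a discrete memoryless channel with $|\mathcal{X}|=q$, and let $g:\mathcal{X}^\ell\to\mathcal{X}^\ell$ be a bijection (the kernel). Assume that there exist $u_0^{\ell-2}\in\mathcal{X}^{\ell-1}$, $(i,j)\in\{0,1,\dots,\ell-1\}^2$ with $i\neq j$, and permutations $\sigma$ and $\tau$ on $\mathcal{X}$ such that, for all $u_{\ell-1}\in\mathcal{X}$, the $i$-th element of $g(u_0^{\ell-1})$ and the $j$-th element of $g(u_0^{\ell-1})$ are $\sigma(u_{\ell-1})$ and $\tau(u_{\ell-1})$, respectively; and such that for any $v_0^{\ell-2}\in\mathcal{X}^{\ell-1}$ with $v_0^{\ell-2}\ne u_0^{\ell-2}$ there exist $m\in\{0,1,\dots,\ell-1\}$ and a permutation $\mu$ on $\mathcal{X}$ such that, for all $v_{\ell-1}\in\mathcal{X}$, the $m$-th element of $g(v_0^{\ell-1})$ is $\mu(v_{\ell-1})$. Let $W_n=W^{(B_1)\cdots(B_n)}$. Then $$\lim_{n\to\infty}P\left(Z^{\tau\sigma^{-1}}_{x,x'}(W_n)\in(\delta,1-\delta)\right)=0$$ for all $x\in\mathcal{X}$, $x'\in\mathcal{X}$ and $\delta\in(0,1/2)$.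
   Context: Notation: $u_i^j=(u_i,\dots,u_j)$; vector entries are indexed from $0$. A discrete memoryless channel (DMC) $W:\mathcal{X}\to\mathcal{Y}$ with finite input alphabet $\mathcal{X}$, $|\mathcal{X}|=q$, and at most countable output alphabet $\mathcal{Y}$ is a family of probability distributions $W(\cdot\mid x)$ on $\mathcal{Y}$, $x\in\mathcal{X}$. Channel transform: set $W^\ell(y_0^{\ell-1}\mid x_0^{\ell-1})=\prod_{i=0}^{\ell-1}W(y_i\mid x_i)$, and for $i\in\{0,\dots,\ell-1\}$ define the DMC $W^{(i)}:\mathcal{X}\to\mathcal{Y}^\ell\times\mathcal{X}^{i}$ by $$W^{(i)}(y_0^{\ell-1},u_0^{i-1}\mid u_i)=\frac1{q^{\ell-1}}\sum_{u_{i+1}^{\ell-1}\in\mathcal{X}^{\ell-1-i}}W^\ell(y_0^{\ell-1}\mid g(u_0^{\ell-1})).$$ Iterating, $W^{(b_1)\cdots(b_n)}=(W^{(b_1)\cdots(b_{n-1})})^{(b_n)}$. The sequence $B_1,B_2,\dots$ consists of independent random variables uniform on $\{0,\dots,\ell-1\}$. For a DMC $W$ and $x,x'\in\mathcal{X}$, $Z_{x,x'}(W)=\sum_{y\in\mathcal{Y}}\sqrt{W(y\mid x)W(y\mid x')}$. For a permutation $\rho$ of $\mathcal{X}$, $Z^{\rho}_{x,x'}(W)=\frac1{q!}\sum_{i=0}^{q!-1}Z_{\rho^i(x),\rho^i(x')}(W)$, where $\rho^i$ is the $i$-th power of $\rho$ under composition. *)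

theory Defs
  imports "HOL-Probability.Probability"
begin

text \<open>
  A discrete memoryless channel with input alphabet \<open>'x\<close> and output alphabet \<open>'o\<close> is a
  family \<open>W :: 'x \<Rightarrow> 'o pmf\<close>; \<open>W(y | x)\<close> is \<open>pmf (W x) y\<close>.  Vectors over the input
  alphabet are lists of the appropriate length, and a kernel \<open>g\<close> is only ever applied to lists
  of length \<open>l\<close>.
\<close>

definition channel_transform ::
  "nat \<Rightarrow> ('x list \<Rightarrow> 'x list) \<Rightarrow> ('x::finite \<Rightarrow> 'o pmf) \<Rightarrow> nat \<Rightarrow> 'x \<Rightarrow> ('o list \<times> 'x list) pmf"
where
  "channel_transform l g W i a = embed_pmf (\<lambda>(ys, us).
     if length ys = l \<and> length us = i
     then 1 / real CARD('x) ^ (l - 1) *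
       (\<Sum>ws | length ws = l - 1 - i. \<Prod>k<l. pmf (W (g (us @ [a] @ ws) ! k)) (ys ! k))
     else 0)"

text \<open>
  The output alphabet changes with every application of the transform.  All iterates are
  therefore placed in one type of trees: \<open>Output y\<close> is an output of the original channel, and
  \<open>Block ys us\<close> is the pair of a vector of outputs of the previous channel and a vector of
  input symbols.
\<close>

datatype ('x, 'y) out_symbol = Output 'y | Block "('x, 'y) out_symbol list" "'x list"

definition iterated_channel ::
  "nat \<Rightarrow> ('x list \<Rightarrow> 'x list) \<Rightarrow> ('x::finite \<Rightarrow> 'y pmf) \<Rightarrow> nat list \<Rightarrow> 'x \<Rightarrow> ('x, 'y) out_symbol pmf"
where
  "iterated_channel l g W bs =
     foldl (\<lambda>V b x. map_pmf (\<lambda>(ys, us). Block ys us) (channel_transform l g V b x))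
       (\<lambda>x. map_pmf Output (W x)) bs"

definition bhattacharyya :: "('x \<Rightarrow> 'o pmf) \<Rightarrow> 'x \<Rightarrow> 'x \<Rightarrow> real" where
  "bhattacharyya W x x' = (\<Sum>\<^sub>\<infinity>y. sqrt (pmf (W x) y * pmf (W x') y))"

definition bhattacharyya_perm :: "('x \<Rightarrow> 'x) \<Rightarrow> ('x::finite \<Rightarrow> 'o pmf) \<Rightarrow> 'x \<Rightarrow> 'x \<Rightarrow> real" where
  "bhattacharyya_perm \<rho> W x x' =
     1 / fact CARD('x) * (\<Sum>i<fact CARD('x). bhattacharyya W ((\<rho> ^^ i) x) ((\<rho> ^^ i) x'))"

text \<open>
  The defining formula of the transform is a probability mass function, so that the use of
  \<^const>\<open>embed_pmf\<close> is justified; the series defining the Bhattacharyya parameter converges.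
\<close>

fun list_pmf :: "'o pmf list \<Rightarrow> 'o list pmf" where
  "list_pmf [] = return_pmf []"
| "list_pmf (P # Ps) = map_pmf (\<lambda>(y, ys). y # ys) (pair_pmf P (list_pmf Ps))"

lemma pmf_list_pmf:
  "pmf (list_pmf Ps) ys =
     (if length ys = length Ps then \<Prod>k<length Ps. pmf (Ps ! k) (ys ! k) else 0)"
proof (induction Ps arbitrary: ys)
  case Nil
  then show ?case by (auto simp: indicator_def)
next
  case (Cons P Ps)
  show ?case
  proof (cases ys)
    case Nil
    then show ?thesis by (auto simp: pmf_eq_0_set_pmf)
  next
    case (Cons z zs)
    have "inj (\<lambda>(y::'a, ys). y # ys)" by (auto simp: inj_on_def)
    from pmf_map_inj'[OF this, of "pair_pmf P (list_pmf Ps)" "(z, zs)"]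
    have "pmf (list_pmf (P # Ps)) ys = pmf P z * pmf (list_pmf Ps) zs"
      by (simp add: Cons pmf_pair)
    then show ?thesis
      using Cons.IH by (simp add: Cons prod.lessThan_Suc_shift del: prod.lessThan_Suc)
  qed
qed

lemma pmf_channel_transform:
  fixes W :: "'x::finite \<Rightarrow> 'o pmf"
  assumes "i < l"
  shows "pmf (channel_transform l g W i a) (ys, us) =
     (if length ys = l \<and> length us = i
      then 1 / real CARD('x) ^ (l - 1) *
        (\<Sum>ws | length ws = l - 1 - i. \<Prod>k<l. pmf (W (g (us @ [a] @ ws) ! k)) (ys ! k))
      else 0)"
proof -
  define q where "q = real CARD('x)"
  have q: "q > 0" by (simp add: q_def)
  define L where "L = (\<lambda>n. {ws::'x list. length ws = n})"
  have L: "finite (L n)" "real (card (L n)) = q ^ n" for n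
    using finite_lists_length_eq[of "UNIV::'x set" n] card_lists_length_eq[of "UNIV::'x set" n]
    by (simp_all add: L_def q_def)
  define P where "P = (\<lambda>us ws. list_pmf (map (\<lambda>k. W (g (us @ [a] @ ws) ! k)) [0..<l]))"
  have P: "pmf (P us ws) ys =
      (if length ys = l then \<Prod>k<l. pmf (W (g (us @ [a] @ ws) ! k)) (ys ! k) else 0)" for us ws ys
    by (simp add: P_def pmf_list_pmf)
  define f where "f = (\<lambda>(ys, us). if length ys = l \<and> length us = i
     then 1 / q ^ (l - 1) *
       (\<Sum>ws | length ws = l - 1 - i. \<Prod>k<l. pmf (W (g (us @ [a] @ ws) ! k)) (ys ! k)) else 0)"
  have f: "f (ys, us) = indicator (L i) us * (1 / q ^ (l - 1)) * (\<Sum>ws\<in>L (l - 1 - i). pmf (P us ws) ys)"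
    for ys us
    by (auto simp: f_def L_def P indicator_def)
  have nonneg: "0 \<le> f z" for z
    using q by (auto simp: f_def split: prod.splits intro!: divide_nonneg_nonneg sum_nonneg prod_nonneg)
  have inner: "(\<integral>\<^sup>+ys. ennreal (f (ys, us)) \<partial>count_space UNIV) =
      ennreal (q ^ (l - 1 - i) / q ^ (l - 1)) * indicator (L i) us" for us
  proof -
    have "ennreal (f (ys, us)) = ennreal (indicator (L i) us * (1 / q ^ (l - 1))) *
        (\<Sum>ws\<in>L (l - 1 - i). ennreal (pmf (P us ws) ys))" for ys
      unfolding f using q by (subst ennreal_mult) (auto simp: sum_ennreal intro!: sum_nonneg)
    then have "(\<integral>\<^sup>+ys. ennreal (f (ys, us)) \<partial>count_space UNIV) =
        ennreal (indicator (L i) us * (1 / q ^ (l - 1))) *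
        (\<Sum>ws\<in>L (l - 1 - i). \<integral>\<^sup>+ys. ennreal (pmf (P us ws) ys) \<partial>count_space UNIV)"
      by (simp add: nn_integral_cmult nn_integral_sum del: sum_ennreal)
    also have "\<dots> = ennreal (indicator (L i) us * (1 / q ^ (l - 1))) * ennreal (q ^ (l - 1 - i))"
      by (simp add: nn_integral_pmf_eq_1 ennreal_of_nat_eq_real_of_nat L)
    also have "\<dots> = ennreal (q ^ (l - 1 - i) / q ^ (l - 1)) * indicator (L i) us"
      using q by (auto simp: indicator_def ennreal_mult[symmetric])
    finally show ?thesis .
  qed
  have "(\<integral>\<^sup>+z. ennreal (f z) \<partial>count_space UNIV) =
      (\<integral>\<^sup>+us. \<integral>\<^sup>+ys. ennreal (f (ys, us)) \<partial>count_space UNIV \<partial>count_space UNIV)"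
    using nn_integral_snd_count_space[of "\<lambda>z. ennreal (f z)"] by simp
  also have "\<dots> = ennreal (q ^ (l - 1 - i) / q ^ (l - 1)) * ennreal (q ^ i)"
    by (simp add: inner nn_integral_cmult_indicator L ennreal_of_nat_eq_real_of_nat)
  also have "\<dots> = ennreal (q ^ (l - 1 - i + i) / q ^ (l - 1))"
    using q by (simp add: ennreal_mult[symmetric] power_add)
  also have "\<dots> = 1"
    using q assms by simp
  finally have "(\<integral>\<^sup>+z. ennreal (f z) \<partial>count_space UNIV) = 1" .
  moreover have "channel_transform l g W i a = embed_pmf f"
    by (simp only: channel_transform_def f_def q_def)
  ultimately have "pmf (channel_transform l g W i a) (ys, us) = f (ys, us)"
    using nonneg by (simp add: pmf_embed_pmf)
  then show ?thesis by (simp add: f_def q_def)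
qed

lemma summable_bhattacharyya:
  fixes W :: "'x \<Rightarrow> 'o pmf"
  shows "(\<lambda>y. sqrt (pmf (W x) y * pmf (W x') y)) summable_on UNIV"
proof (rule summable_on_comparison_test)
  have "pmf p summable_on UNIV" for p :: "'o pmf"
    using pmf_abs_summable[of p UNIV] abs_summable_equivalent[of "pmf p" UNIV]
    by (auto intro: abs_summable_summable)
  then show "(\<lambda>y. pmf (W x) y + pmf (W x') y) summable_on UNIV"
    by (intro summable_on_add)
  have *: "s \<le> a + b" if "s \<le> (a + b) / 2" "0 \<le> a" "0 \<le> b" for s a b :: real
    using that by simp
  show "sqrt (pmf (W x) y * pmf (W x') y) \<le> pmf (W x) y + pmf (W x') y" for y
    by (intro * arith_geo_mean_sqrt pmf_nonneg)
qed simp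

end

(*
Write H(V) for the entropy of the uniformly distributed input of a channel V given its output.  By the
chain rule the average of H over the l transforms of V is H(V), so H(W_n) is a bounded martingale and
its increments tend to 0 in mean square.  The hypotheses on the kernel make the last transform lose
entropy: conditioned on v \<noteq> u, the last input is seen at least as well as through one use of V, and
conditioned on u it is seen through two uses, with inputs relabelled by \<sigma> and \<tau>.  The loss due to the
second use is a relative entropy, hence at least a squared Hellinger distance, and that is at least a
constant times Z_{a,b}^2 (1 - Z_{\<rho> a,\<rho> b}) where \<rho> = \<tau> \<sigma>^{-1}.  So with high probability all these
products are small; following the finite orbit of (x,x') under \<rho>, the parameters along it are then
all small or all close to 1, and so is their average.
*)
theory Submission
  imports Defs "HOL-Combinatorics.Cycles"
begin

section \<open>Conditional entropy\<close>

text \<open>The product Z_{a,b}^2 (1 - Z_{\<rho> a,\<rho> b}) combines two conditions. A second use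
  helps only if the first leaves a and b confused, which Z_{\<sigma> a,\<sigma> b} measures, and
  only if the second separates them, which 1 - Z_{\<tau> a,\<tau> b} measures; renaming inputs by
  the inverse of \<sigma> makes the second pair the \<rho>-image of the first. The constant in front
  depends on q and l but not on the channel, so one estimate serves all iterates although their
  output alphabets grow. A small product is a one-way statement: a parameter above \<delta> is
  followed by one above 1 - \<delta>. Only on a closed orbit does this implication return to its
  start. The output alphabet may be infinite, so entropies and Hellinger sums are extended
  nonnegative integrals, and inequalities carry sums on both sides instead of differences.
  Convergence in probability is all that is claimed, so second moments of finite averages over words
  suffice.\<close>

text \<open>A random variable enters only through its partition into level sets. Recoding or
  regrouping variables then amounts to comparing when two samples agree.\<close>

definition level_prob :: "'s pmf \<Rightarrow> ('s \<Rightarrow> 'a) \<Rightarrow> 's \<Rightarrow> real" where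
  "level_prob p F s = pmf (map_pmf F p) (F s)"

text \<open>H(X | Y) in nats, as the mean of \<open>- ln\<close> of the conditional probability of
  \<open>X\<close> given \<open>Y\<close>. That probability is at most 1 on the support, so
  \<open>ennreal\<close> cuts nothing off there, and the integral makes sense for infinite alphabets
  as well.\<close>

definition cond_entropy :: "'s pmf \<Rightarrow> ('s \<Rightarrow> 'a) \<Rightarrow> ('s \<Rightarrow> 'b) \<Rightarrow> ennreal" where
  "cond_entropy p X Y =
     (\<integral>\<^sup>+s. ennreal (- ln (level_prob p (\<lambda>s. (X s, Y s)) s / level_prob p Y s)) \<partial>measure_pmf p)"

lemma level_prob_eq: "level_prob p F s = measure_pmf.prob p {t. F t = F s}"
  by (simp add: level_prob_def pmf_map vimage_def)

lemma level_prob_pos: "s \<in> set_pmf p \<Longrightarrow> level_prob p F s > 0"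
  by (auto simp: level_prob_def pmf_positive)

lemma level_prob_mono:
  assumes "\<And>t. t \<in> set_pmf p \<Longrightarrow> F t = F s \<Longrightarrow> G t = G s"
  shows "level_prob p F s \<le> level_prob p G s"
proof -
  have "measure_pmf.prob p ({t. F t = F s} \<inter> set_pmf p) \<le> measure_pmf.prob p ({t. G t = G s} \<inter> set_pmf p)"
    using assms by (intro measure_pmf.finite_measure_mono) auto
  then show ?thesis
    by (simp add: level_prob_eq measure_Int_set_pmf)
qed

lemma level_prob_cong:
  assumes "\<And>t. t \<in> set_pmf p \<Longrightarrow> F t = F s \<longleftrightarrow> G t = G s"
  shows "level_prob p F s = level_prob p G s"
  using assms by (intro antisym level_prob_mono) auto

lemma level_prob_map: "level_prob (map_pmf f p) F (f s) = level_prob p (\<lambda>s. F (f s)) s"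
  by (simp add: level_prob_def map_pmf_comp)

lemma cond_entropy_map:
  "cond_entropy (map_pmf f p) X Y = cond_entropy p (\<lambda>s. X (f s)) (\<lambda>s. Y (f s))"
  by (simp add: cond_entropy_def level_prob_map)

text \<open>The code for \<open>X\<close> has to be faithful only within a level of
  \<open>Y\<close>. This admits a relabelling of the input that depends on what is observed, as by
  \<open>inv (\<mu> v)\<close> later on.\<close>

lemma cond_entropy_cong:
  assumes "\<And>s t. s \<in> set_pmf p \<Longrightarrow> t \<in> set_pmf p \<Longrightarrow> Y t = Y s \<longleftrightarrow> Y' t = Y' s"
    and "\<And>s t. s \<in> set_pmf p \<Longrightarrow> t \<in> set_pmf p \<Longrightarrow> Y t = Y s \<Longrightarrow> X t = X s \<longleftrightarrow> X' t = X' s"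
  shows "cond_entropy p X Y = cond_entropy p X' Y'"
  unfolding cond_entropy_def
proof (intro nn_integral_cong_AE, unfold AE_measure_pmf_iff, intro ballI)
  fix s assume s: "s \<in> set_pmf p"
  have "level_prob p Y s = level_prob p Y' s"
    using assms(1)[OF s] by (rule level_prob_cong)
  moreover have "level_prob p (\<lambda>s. (X s, Y s)) s = level_prob p (\<lambda>s. (X' s, Y' s)) s"
    using assms s by (intro level_prob_cong) auto
  ultimately show "ennreal (- ln (level_prob p (\<lambda>s. (X s, Y s)) s / level_prob p Y s)) =
      ennreal (- ln (level_prob p (\<lambda>s. (X' s, Y' s)) s / level_prob p Y' s))" by simp
qed

lemma neg_ln_ratio_nonneg:
  assumes "s \<in> set_pmf p" "\<And>t. F t = F s \<Longrightarrow> G t = G s"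
  shows "0 \<le> - ln (level_prob p F s / level_prob p G s)"
proof -
  have "level_prob p F s \<le> level_prob p G s"
    using assms(2) by (rule level_prob_mono)
  then have "level_prob p F s / level_prob p G s \<le> 1"
    using level_prob_pos[OF assms(1), of G] by simp
  then show ?thesis
    using level_prob_pos[OF assms(1), of F] level_prob_pos[OF assms(1), of G] by simp
qed

text \<open>The identity holds sample by sample: the level probability of \<open>(Y, X)\<close>
  cancels between the two ratios. Both negated logarithms are nonnegative on the support, so the sum
  in \<open>ennreal\<close> is exact.\<close>

lemma cond_entropy_chain:
  "cond_entropy p (\<lambda>s. (X s, X' s)) Y =
     cond_entropy p X Y + cond_entropy p X' (\<lambda>s. (Y s, X s))"
proof -
  have "ennreal (- ln (level_prob p (\<lambda>s. ((X s, X' s), Y s)) s / level_prob p Y s)) =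
     ennreal (- ln (level_prob p (\<lambda>s. (X s, Y s)) s / level_prob p Y s)) +
     ennreal (- ln (level_prob p (\<lambda>s. (X' s, (Y s, X s))) s / level_prob p (\<lambda>s. (Y s, X s)) s))"
    if s: "s \<in> set_pmf p" for s
  proof -
    have eq: "level_prob p (\<lambda>s. ((X s, X' s), Y s)) s = level_prob p (\<lambda>s. (X' s, (Y s, X s))) s"
      "level_prob p (\<lambda>s. (X s, Y s)) s = level_prob p (\<lambda>s. (Y s, X s)) s"
      by (auto intro!: level_prob_cong)
    have "ennreal (- ln (level_prob p (\<lambda>s. (X s, Y s)) s / level_prob p Y s)) +
     ennreal (- ln (level_prob p (\<lambda>s. (X' s, (Y s, X s))) s / level_prob p (\<lambda>s. (Y s, X s)) s)) =
     ennreal (- ln (level_prob p (\<lambda>s. (X s, Y s)) s / level_prob p Y s) +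
        - ln (level_prob p (\<lambda>s. (X' s, (Y s, X s))) s / level_prob p (\<lambda>s. (Y s, X s)) s))"
      by (intro ennreal_plus[symmetric] neg_ln_ratio_nonneg s) auto
    also have "- ln (level_prob p (\<lambda>s. (X s, Y s)) s / level_prob p Y s) +
        - ln (level_prob p (\<lambda>s. (X' s, (Y s, X s))) s / level_prob p (\<lambda>s. (Y s, X s)) s) =
        - ln (level_prob p (\<lambda>s. ((X s, X' s), Y s)) s / level_prob p Y s)"
      using level_prob_pos[OF s, of Y] level_prob_pos[OF s, of "\<lambda>s. (Y s, X s)"]
        level_prob_pos[OF s, of "\<lambda>s. (X' s, (Y s, X s))"]
      by (simp add: eq ln_div less_imp_neq[symmetric])
    finally show ?thesis by simp
  qed
  then have "cond_entropy p (\<lambda>s. (X s, X' s)) Y = (\<integral>\<^sup>+s.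
      ennreal (- ln (level_prob p (\<lambda>s. (X s, Y s)) s / level_prob p Y s)) +
      ennreal (- ln (level_prob p (\<lambda>s. (X' s, (Y s, X s))) s / level_prob p (\<lambda>s. (Y s, X s)) s)) \<partial>measure_pmf p)"
    unfolding cond_entropy_def by (intro nn_integral_cong_AE) (simp add: AE_measure_pmf_iff)
  then show ?thesis
    unfolding cond_entropy_def by (subst (asm) nn_integral_add) simp_all
qed

lemma nn_integral_pmf_fst:
  "(\<integral>\<^sup>+a. ennreal (pmf p (a, b)) \<partial>count_space UNIV) = ennreal (pmf (map_pmf snd p) b)"
proof -
  have "(\<integral>\<^sup>+a. ennreal (pmf p (a, b)) \<partial>count_space UNIV) = emeasure (measure_pmf p) ((\<lambda>a. (a, b)) ` UNIV)"
    by (intro nn_integral_pmf' inj_onI) simp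
  also have "(\<lambda>a. (a, b)) ` UNIV = snd -` {b}" by auto
  finally show ?thesis by (simp add: pmf_map measure_pmf.emeasure_eq_measure)
qed

text \<open>From \<open>ln t \<le> t\<close>, each term is at most the probability of the value of
  \<open>Y\<close>, and each value of \<open>Y\<close> is counted once per letter of
  \<open>'a\<close>. The bound is free of the output alphabet, which keeps the martingale bounded
  along the iteration.\<close>

lemma cond_entropy_le_card:
  fixes X :: "'s \<Rightarrow> 'a::finite"
  shows "cond_entropy p X Y \<le> of_nat CARD('a)"
proof -
  define r where "r = map_pmf (\<lambda>s. (X s, Y s)) p"
  have "cond_entropy p X Y = cond_entropy r fst snd"
    by (simp add: r_def cond_entropy_map)
  also have "\<dots> = (\<integral>\<^sup>+z. ennreal (pmf r z) * ennreal (- ln (pmf r z / pmf (map_pmf snd r) (snd z))) \<partial>count_space UNIV)"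
    by (simp add: cond_entropy_def level_prob_def nn_integral_measure_pmf)
  also have "\<dots> \<le> (\<integral>\<^sup>+z. ennreal (pmf (map_pmf snd r) (snd (z :: 'a \<times> _))) \<partial>count_space UNIV)"
  proof (intro nn_integral_mono)
    fix z :: "'a \<times> _"
    show "ennreal (pmf r z) * ennreal (- ln (pmf r z / pmf (map_pmf snd r) (snd z)))
      \<le> ennreal (pmf (map_pmf snd r) (snd z))"
    proof (cases "z \<in> set_pmf r")
      case True
      then have pos: "pmf r z > 0" "pmf (map_pmf snd r) (snd z) > 0"
        by (auto intro!: pmf_positive)
      have "- ln (pmf r z / pmf (map_pmf snd r) (snd z)) = ln (pmf (map_pmf snd r) (snd z) / pmf r z)"
        using pos by (simp add: ln_div)
      also have "\<dots> \<le> pmf (map_pmf snd r) (snd z) / pmf r z"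
        using pos ln_le_minus_one[of "pmf (map_pmf snd r) (snd z) / pmf r z"] by simp
      finally have "pmf r z * (- ln (pmf r z / pmf (map_pmf snd r) (snd z))) \<le> pmf (map_pmf snd r) (snd z)"
        using pos by (simp add: field_simps)
      then show ?thesis by (simp add: ennreal_mult'[symmetric] ennreal_leI)
    qed (simp add: set_pmf_iff)
  qed
  also have "\<dots> = (\<integral>\<^sup>+a. \<integral>\<^sup>+b. ennreal (pmf (map_pmf snd r) b) \<partial>count_space UNIV \<partial>count_space (UNIV::'a set))"
    by (subst nn_integral_fst_count_space[symmetric]) simp
  also have "\<dots> = of_nat CARD('a)"
    by (simp add: nn_integral_pmf_eq_1)
  finally show ?thesis .
qed

text \<open>The gain is the squared Hellinger distance to the law under which \<open>a\<close> and \<open>b\<close> are conditionally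
  independent given \<open>f b\<close>; it bounds the difference, which is a relative entropy, by \<open>ln t \<le> t - 1\<close>.\<close>

lemma cond_entropy_factor:
  fixes p :: "('a \<times> 'b) pmf" and f :: "'b \<Rightarrow> 'c"
  defines "r \<equiv> \<lambda>(a, b). pmf (map_pmf snd p) b *
    (pmf (map_pmf (\<lambda>(a, b). (a, f b)) p) (a, f b) / pmf (map_pmf (\<lambda>(a, b). f b) p) (f b))"
  shows "cond_entropy p fst snd + (\<integral>\<^sup>+z. ennreal ((sqrt (pmf p z) - sqrt (r z))\<^sup>2) \<partial>count_space UNIV)
    \<le> cond_entropy p fst (\<lambda>z. f (snd z))"
proof -
  \<comment> \<open>The affinity of \<open>p\<close> and \<open>r\<close>; expanding the square
    bounds the squared Hellinger distance plus \<open>2 * B\<close> by 2.\<close>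
  define B where "B = (\<integral>\<^sup>+z. ennreal (sqrt (pmf p z * r z)) \<partial>count_space UNIV)"
  have r0: "r z \<ge> 0" for z by (cases z) (simp add: r_def)
  \<comment> \<open>Summing over the first coordinate for fixed \<open>b\<close> cancels the
    denominator of \<open>c b\<close>. Where that denominator is 0, the quotient is 0 too, hence
    \<open>\<le>\<close>.\<close>
  have sum_r: "(\<integral>\<^sup>+z. ennreal (r z) \<partial>count_space UNIV) \<le> 1"
  proof -
    define c where "c = (\<lambda>b. pmf (map_pmf snd p) b / pmf (map_pmf (\<lambda>(a, b). f b) p) (f b))"
    have mp: "map_pmf snd (map_pmf (\<lambda>(a, b). (a, f b)) p) = map_pmf (\<lambda>(a, b). f b) p"
      by (simp add: map_pmf_comp case_prod_unfold)
    have "(\<integral>\<^sup>+z. ennreal (r z) \<partial>count_space UNIV) =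
      (\<integral>\<^sup>+b. \<integral>\<^sup>+a. ennreal (r (a, b)) \<partial>count_space UNIV \<partial>count_space UNIV)"
      by (subst nn_integral_snd_count_space) simp
    also have "\<dots> = (\<integral>\<^sup>+b. \<integral>\<^sup>+a. ennreal (c b) * ennreal (pmf (map_pmf (\<lambda>(a, b). (a, f b)) p) (a, f b)) \<partial>count_space UNIV \<partial>count_space UNIV)"
      by (intro nn_integral_cong) (simp add: r_def c_def ennreal_mult[symmetric] field_simps)
    also have "\<dots> = (\<integral>\<^sup>+b. ennreal (c b) * ennreal (pmf (map_pmf (\<lambda>(a, b). f b) p) (f b)) \<partial>count_space UNIV)"
      by (simp add: nn_integral_cmult nn_integral_pmf_fst mp)
    also have "\<dots> \<le> (\<integral>\<^sup>+b. ennreal (pmf (map_pmf snd p) b) \<partial>count_space UNIV)"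
      by (intro nn_integral_mono) (simp add: c_def ennreal_mult[symmetric])
    also have "\<dots> = 1" by (simp add: nn_integral_pmf_eq_1)
    finally show ?thesis .
  qed
  have sum_p: "(\<integral>\<^sup>+z. ennreal (pmf p z) \<partial>count_space UNIV) = 1"
    by (simp add: nn_integral_pmf_eq_1)
  have hell: "(\<integral>\<^sup>+z. ennreal ((sqrt (pmf p z) - sqrt (r z))\<^sup>2) \<partial>count_space UNIV) + 2 * B \<le> 2"
  proof -
    have "(\<integral>\<^sup>+z. ennreal ((sqrt (pmf p z) - sqrt (r z))\<^sup>2) \<partial>count_space UNIV) + 2 * B =
       (\<integral>\<^sup>+z. ennreal ((sqrt (pmf p z) - sqrt (r z))\<^sup>2) + 2 * ennreal (sqrt (pmf p z * r z)) \<partial>count_space UNIV)"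
      by (simp add: nn_integral_add nn_integral_cmult B_def)
    also have "\<dots> = (\<integral>\<^sup>+z. ennreal (pmf p z) + ennreal (r z) \<partial>count_space UNIV)"
    proof (intro nn_integral_cong)
      fix z
      have "ennreal ((sqrt (pmf p z) - sqrt (r z))\<^sup>2) + 2 * ennreal (sqrt (pmf p z * r z)) =
        ennreal ((sqrt (pmf p z) - sqrt (r z))\<^sup>2 + 2 * sqrt (pmf p z * r z))"
        by (subst ennreal_plus) (simp_all add: r0 ennreal_mult)
      also have "(sqrt (pmf p z) - sqrt (r z))\<^sup>2 + 2 * sqrt (pmf p z * r z) = pmf p z + r z"
        by (simp add: power2_diff real_sqrt_mult r0)
      finally show "ennreal ((sqrt (pmf p z) - sqrt (r z))\<^sup>2) + 2 * ennreal (sqrt (pmf p z * r z)) =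
        ennreal (pmf p z) + ennreal (r z)" by (simp add: r0)
    qed
    also have "\<dots> \<le> 1 + 1"
      by (simp add: nn_integral_add sum_p) (metis add_left_mono one_add_one sum_r)
    finally show ?thesis by simp
  qed
  define h where "h = (\<lambda>z. - ln (level_prob p (\<lambda>z. (fst z, snd z)) z / level_prob p snd z))"
  define h' where "h' = (\<lambda>z. - ln (level_prob p (\<lambda>z. (fst z, f (snd z))) z / level_prob p (\<lambda>z. f (snd z)) z))"
  \<comment> \<open>The 2 moves the \<open>- 1\<close> of \<open>ln t \<le> t - 1\<close> to the
    left, since subtraction in \<open>ennreal\<close> would truncate. The inequality is applied to
    the square root of \<open>r z / pmf p z\<close>, whose mean is the affinity
    \<open>B\<close>.\<close>
  have "cond_entropy p fst snd + 2 = (\<integral>\<^sup>+z. ennreal (h z) + 2 \<partial>measure_pmf p)"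
    by (simp add: cond_entropy_def nn_integral_add h_def)
  also have "\<dots> \<le> (\<integral>\<^sup>+z. ennreal (h' z) + 2 * ennreal (sqrt (r z / pmf p z)) \<partial>measure_pmf p)"
  proof (intro nn_integral_mono_AE, unfold AE_measure_pmf_iff, intro ballI)
    fix z assume z: "z \<in> set_pmf p"
    obtain a b where ab: "z = (a, b)" by (cases z)
    have pz: "level_prob p (\<lambda>z. (fst z, snd z)) z = pmf p z" "pmf p z > 0"
      using z by (simp_all add: level_prob_def pmf_positive)
    have rz: "r z = level_prob p snd z * (level_prob p (\<lambda>z. (fst z, f (snd z))) z / level_prob p (\<lambda>z. f (snd z)) z)"
      by (simp add: r_def ab level_prob_def case_prod_unfold)
    have rpos: "r z > 0"
      unfolding rz by (intro mult_pos_pos divide_pos_pos level_prob_pos z)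
    have "h z - h' z = ln (r z / pmf p z)"
      using pz rpos level_prob_pos[OF z, of snd] level_prob_pos[OF z, of "\<lambda>z. (fst z, f (snd z))"]
        level_prob_pos[OF z, of "\<lambda>z. f (snd z)"]
      by (simp add: h_def h'_def rz ln_div ln_mult less_imp_neq[symmetric])
    also have "\<dots> = 2 * ln (sqrt (r z / pmf p z))"
      using rpos pz by (simp add: ln_sqrt)
    also have "\<dots> \<le> 2 * (sqrt (r z / pmf p z) - 1)"
      using rpos pz by (intro mult_left_mono ln_le_minus_one) auto
    finally have le: "h z + 2 \<le> h' z + 2 * sqrt (r z / pmf p z)" by simp
    have h0: "h z \<ge> 0" "h' z \<ge> 0"
      unfolding h_def h'_def by (intro neg_ln_ratio_nonneg z; auto)+
    have "ennreal (h z) + 2 = ennreal (h z + 2)"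
      using h0 by simp
    also have "\<dots> \<le> ennreal (h' z + 2 * sqrt (r z / pmf p z))"
      using le by (rule ennreal_leI)
    also have "\<dots> = ennreal (h' z) + 2 * ennreal (sqrt (r z / pmf p z))"
      using h0 r0[of z] by (simp add: ennreal_mult)
    finally show "ennreal (h z) + 2 \<le> ennreal (h' z) + 2 * ennreal (sqrt (r z / pmf p z))" .
  qed
  also have "\<dots> = cond_entropy p fst (\<lambda>z. f (snd z)) + 2 * (\<integral>\<^sup>+z. ennreal (sqrt (r z / pmf p z)) \<partial>measure_pmf p)"
    by (simp add: cond_entropy_def nn_integral_add nn_integral_cmult h'_def)
  also have "(\<integral>\<^sup>+z. ennreal (sqrt (r z / pmf p z)) \<partial>measure_pmf p) = B"
    unfolding nn_integral_measure_pmf B_def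
  proof (intro nn_integral_cong)
    fix z
    have "pmf p z * sqrt (r z / pmf p z) = sqrt (pmf p z * r z)"
    proof (cases "pmf p z = 0")
      case False
      then have "pmf p z > 0" by (simp add: pmf_pos)
      then have "pmf p z * sqrt (r z / pmf p z) = sqrt ((pmf p z)\<^sup>2) * sqrt (r z / pmf p z)" by simp
      also have "\<dots> = sqrt (pmf p z * r z)"
        using False by (simp only: real_sqrt_mult[symmetric]) (simp add: power2_eq_square)
      finally show ?thesis .
    qed simp
    then show "ennreal (pmf p z) * ennreal (sqrt (r z / pmf p z)) = ennreal (sqrt (pmf p z * r z))"
      by (simp add: ennreal_mult'[symmetric] r0)
  qed
  finally have ent: "cond_entropy p fst snd + 2 \<le> cond_entropy p fst (\<lambda>z. f (snd z)) + 2 * B" .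
  \<comment> \<open>Cancelling \<open>2 * B\<close> in \<open>ennreal\<close> requires it to be
    finite.\<close>
  have fin: "2 * B < \<top>"
  proof (rule order.strict_trans1)
    show "2 * B \<le> 2"
      by (rule order.trans[OF _ hell]) simp
  qed simp
  have "2 * B + (cond_entropy p fst snd + (\<integral>\<^sup>+z. ennreal ((sqrt (pmf p z) - sqrt (r z))\<^sup>2) \<partial>count_space UNIV))
     \<le> cond_entropy p fst snd + 2"
    using add_left_mono[OF hell, of "cond_entropy p fst snd"] by (simp add: ac_simps)
  also note ent
  finally show ?thesis
    using fin by (auto simp: add.commute[of _ "2 * B"] ennreal_add_left_cancel_le)
qed

section \<open>The entropy of a channel and its conservation\<close>

definition joint :: "('x::finite \<Rightarrow> 'o pmf) \<Rightarrow> ('x \<times> 'o) pmf" where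
  "joint V = bind_pmf (pmf_of_set UNIV) (\<lambda>x. map_pmf (Pair x) (V x))"

text \<open>\<open>ln CARD('x)\<close> minus the mutual information of \<open>V\<close> under
  uniform input.\<close>

definition channel_entropy :: "('x::finite \<Rightarrow> 'o pmf) \<Rightarrow> ennreal" where
  "channel_entropy V = cond_entropy (joint V) fst snd"

definition block :: "nat \<Rightarrow> ('x::finite \<Rightarrow> 'o pmf) \<Rightarrow> ('x \<times> 'o) list pmf" where
  "block l V = list_pmf (replicate l (joint V))"

lemma pmf_joint: "pmf (joint V) (x, y) = pmf (V x) y / CARD('x)" for V :: "'x::finite \<Rightarrow> 'o pmf"
proof -
  have "pmf (map_pmf (Pair x') (V x')) (x, y) = (if x' = x then pmf (V x) y else 0)" for x'
    using pmf_map_inj'[of "Pair x'" "V x'" y] by (auto simp: inj_on_def pmf_eq_0_set_pmf)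
  then show ?thesis
    by (simp add: joint_def pmf_bind_pmf_of_set)
qed

section \<open>Coordinates of product laws on lists\<close>

lemma map_list_pmf: "map_pmf (map f) (list_pmf Ps) = list_pmf (map (map_pmf f) Ps)"
proof (induction Ps)
  case (Cons P Ps)
  show ?case
    by (simp add: map_pmf_comp case_prod_unfold pair_map_pmf1 pair_map_pmf2 apfst_def apsnd_def map_prod_def flip: Cons.IH)
qed simp

lemma map_nth_list_pmf: "k < length Ps \<Longrightarrow> map_pmf (\<lambda>ys. ys ! k) (list_pmf Ps) = Ps ! k"
proof (induction Ps arbitrary: k)
  case (Cons P Ps)
  show ?case
  proof (cases k)
    case 0
    then show ?thesis by (simp add: map_pmf_comp case_prod_unfold map_fst_pair_pmf)
  next
    case (Suc k')
    have "map_pmf (\<lambda>ys. ys ! k) (list_pmf (P # Ps)) = map_pmf (\<lambda>ys. ys ! k') (map_pmf snd (pair_pmf P (list_pmf Ps)))"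
      by (simp add: Suc map_pmf_comp case_prod_unfold)
    then show ?thesis
      using Cons Suc by (simp add: map_snd_pair_pmf)
  qed
qed simp

lemma map_nth_pair_list_pmf:
  assumes "i < length Ps" "j < length Ps" "i \<noteq> j"
  shows "map_pmf (\<lambda>ys. (ys ! i, ys ! j)) (list_pmf Ps) = pair_pmf (Ps ! i) (Ps ! j)"
  using assms
proof (induction Ps arbitrary: i j)
  case (Cons P Ps)
  consider j' where "i = 0" "j = Suc j'" | i' where "i = Suc i'" "j = 0"
    | i' j' where "i = Suc i'" "j = Suc j'"
    using Cons.prems(3) by (metis not0_implies_Suc)
  then show ?case
  proof cases
    case 1
    then have "map_pmf (\<lambda>ys. (ys ! i, ys ! j)) (list_pmf (P # Ps)) =
        pair_pmf P (map_pmf (\<lambda>ys. ys ! j') (list_pmf Ps))"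
      by (simp add: map_pmf_comp case_prod_unfold pair_map_pmf2 apsnd_def map_prod_def)
    with 1 Cons.prems show ?thesis by (simp add: map_nth_list_pmf)
  next
    case 2
    then have "map_pmf (\<lambda>ys. (ys ! i, ys ! j)) (list_pmf (P # Ps)) =
        map_pmf (\<lambda>(y, z). (z, y)) (pair_pmf P (map_pmf (\<lambda>ys. ys ! i') (list_pmf Ps)))"
      by (simp add: map_pmf_comp case_prod_unfold pair_map_pmf2 apsnd_def map_prod_def)
    also have "\<dots> = pair_pmf (map_pmf (\<lambda>ys. ys ! i') (list_pmf Ps)) P"
      by (rule pair_commute_pmf[symmetric])
    finally show ?thesis using 2 Cons.prems by (simp add: map_nth_list_pmf)
  next
    case 3
    then have "map_pmf (\<lambda>ys. (ys ! i, ys ! j)) (list_pmf (P # Ps)) =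
        map_pmf (\<lambda>ys. (ys ! i', ys ! j')) (map_pmf snd (pair_pmf P (list_pmf Ps)))"
      by (simp add: map_pmf_comp case_prod_unfold)
    with 3 Cons show ?thesis by (simp add: map_snd_pair_pmf)
  qed
qed simp

lemma length_block: "zs \<in> set_pmf (block l V) \<Longrightarrow> length zs = l"
  by (auto simp: block_def set_pmf_iff pmf_list_pmf split: if_splits)

text \<open>An injective recoding leaves the levels of the output alone. Wrapping outputs in
  \<open>Block\<close> is such a recoding.\<close>

lemma channel_entropy_map:
  assumes "inj f"
  shows "channel_entropy (\<lambda>x. map_pmf f (V x)) = channel_entropy V"
proof -
  have "joint (\<lambda>x. map_pmf f (V x)) = map_pmf (\<lambda>(x, y). (x, f y)) (joint V)"
    by (simp add: joint_def map_bind_pmf map_pmf_comp)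
  then show ?thesis
    using assms
    by (auto simp: channel_entropy_def cond_entropy_map inj_eq intro!: cond_entropy_cong)
qed

lemma channel_entropy_le_card: "channel_entropy V \<le> of_nat CARD('x)" for V :: "'x::finite \<Rightarrow> 'o pmf"
  unfolding channel_entropy_def by (rule cond_entropy_le_card)

text \<open>Both level probabilities of a block factor over its entries, the logarithm turns this
  into a sum, and each entry has law \<open>p\<close>.\<close>

lemma cond_entropy_list_pmf:
  "cond_entropy (list_pmf (replicate l p)) (map fst) (map snd) = of_nat l * cond_entropy p fst snd"
proof -
  define h where "h = (\<lambda>z. - ln (pmf p z / pmf (map_pmf snd p) (snd z)))"
  have h: "cond_entropy p fst snd = (\<integral>\<^sup>+z. ennreal (h z) \<partial>measure_pmf p)"
    by (simp add: cond_entropy_def level_prob_def h_def)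
  have pos: "pmf p z > 0" "pmf (map_pmf snd p) (snd z) > 0" if "z \<in> set_pmf p" for z
    using that by (auto intro!: pmf_positive)
  have h0: "h z \<ge> 0" if "z \<in> set_pmf p" for z
    using neg_ln_ratio_nonneg[OF that, of "\<lambda>z. z" snd] by (simp add: h_def level_prob_def)
  let ?Q = "list_pmf (replicate l p)"
  have "ennreal (- ln (level_prob ?Q (\<lambda>zs. (map fst zs, map snd zs)) zs / level_prob ?Q (map snd) zs)) =
      (\<Sum>k<l. ennreal (h (zs ! k)))" if zs: "zs \<in> set_pmf ?Q" for zs
  proof -
    have len: "length zs = l"
      using zs by (auto simp: set_pmf_iff pmf_list_pmf split: if_splits)
    have mem: "zs ! k \<in> set_pmf p" if "k < l" for k
    proof -
      have "zs ! k \<in> (\<lambda>ys. ys ! k) ` set_pmf ?Q" using zs by (rule imageI)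
      also have "\<dots> = set_pmf p"
        using map_nth_list_pmf[of k "replicate l p"] that by (simp flip: set_map_pmf)
      finally show ?thesis .
    qed
    have 1: "level_prob ?Q (\<lambda>zs. (map fst zs, map snd zs)) zs = (\<Prod>k<l. pmf p (zs ! k))"
    proof -
      have "level_prob ?Q (\<lambda>zs. (map fst zs, map snd zs)) zs = level_prob ?Q (\<lambda>zs. zs) zs"
        by (rule level_prob_cong) (auto intro: pair_list_eqI)
      then show ?thesis by (simp add: level_prob_def pmf_list_pmf len)
    qed
    have 2: "level_prob ?Q (map snd) zs = (\<Prod>k<l. pmf (map_pmf snd p) (snd (zs ! k)))"
      by (simp add: level_prob_def map_list_pmf pmf_list_pmf len)
    have "- ln ((\<Prod>k<l. pmf p (zs ! k)) / (\<Prod>k<l. pmf (map_pmf snd p) (snd (zs ! k)))) = (\<Sum>k<l. h (zs ! k))"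
      unfolding h_def prod_dividef[symmetric]
    proof (subst ln_prod)
      show "pmf p (zs ! k) / pmf (map_pmf snd p) (snd (zs ! k)) \<noteq> 0" if "k \<in> {..<l}" for k
        using that pos[OF mem[of k]] by auto
    qed (simp_all add: sum_negf)
    moreover have "(\<Sum>k<l. ennreal (h (zs ! k))) = ennreal (\<Sum>k<l. h (zs ! k))"
      by (rule sum_ennreal) (simp add: h0 mem)
    ultimately show ?thesis
      by (simp only: 1 2)
  qed
  then have "cond_entropy ?Q (map fst) (map snd) = (\<integral>\<^sup>+zs. (\<Sum>k<l. ennreal (h (zs ! k))) \<partial>measure_pmf ?Q)"
    unfolding cond_entropy_def by (intro nn_integral_cong_AE) (simp add: AE_measure_pmf_iff)
  also have "\<dots> = (\<Sum>k<l. \<integral>\<^sup>+zs. ennreal (h (zs ! k)) \<partial>measure_pmf ?Q)"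
    by (simp add: nn_integral_sum)
  also have "\<dots> = (\<Sum>k<l. cond_entropy p fst snd)"
  proof (intro sum.cong refl)
    fix k assume "k \<in> {..<l}"
    then have "map_pmf (\<lambda>zs. zs ! k) ?Q = p"
      using map_nth_list_pmf[of k "replicate l p"] by simp
    then show "(\<integral>\<^sup>+zs. ennreal (h (zs ! k)) \<partial>measure_pmf ?Q) = cond_entropy p fst snd"
      unfolding h
      using nn_integral_map_pmf[of "\<lambda>zs. zs ! k" ?Q "\<lambda>z. ennreal (h z)"] by simp
  qed
  finally show ?thesis by simp
qed

text \<open>All \<open>l\<close> transforms are realised on one block of \<open>l\<close> independent uses of the channel with uniform
  inputs, from which \<open>U\<close> recovers the argument of the kernel; so the chain rule applies to them.\<close>

lemma joint_channel_transform:
  fixes V :: "'x::finite \<Rightarrow> 'o pmf"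
  assumes g: "bij_betw g {v. length v = l} {v. length v = l}" and b: "b < l"
  defines "U \<equiv> \<lambda>zs. inv_into {v. length v = l} g (map fst zs)"
  shows "joint (channel_transform l g V b) = map_pmf (\<lambda>zs. (U zs ! b, (map snd zs, take b (U zs)))) (block l V)"
proof (rule pmf_eqI)
  fix z :: "'x \<times> 'o list \<times> 'x list"
  obtain a ys us where z: "z = (a, (ys, us))" by (cases z)
  define q where "q = real CARD('x)"
  have Ug: "U (zip (g v) ys) = v" if "length v = l" "length ys = l" for v
    using that bij_betw_apply[OF g, of v] bij_betw_inv_into_left[OF g, of v] by (simp add: U_def)
  have gU: "g (U zs) = map fst zs" "length (U zs) = l" if "length zs = l" for zs :: "('x \<times> 'o) list"
    using that bij_betw_inv_into_right[OF g, of "map fst zs"] bij_betw_apply[OF bij_betw_inv_into[OF g], of "map fst zs"]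
    by (simp_all add: U_def)
  define S where "S = {zs. length zs = l \<and> U zs ! b = a \<and> map snd zs = ys \<and> take b (U zs) = us}"
  have "pmf (map_pmf (\<lambda>zs. (U zs ! b, (map snd zs, take b (U zs)))) (block l V)) z = measure_pmf.prob (block l V) S"
    unfolding pmf_map
    by (intro measure_pmf.finite_measure_eq_AE) (auto simp: AE_measure_pmf_iff S_def z dest: length_block)
  also have "\<dots> = pmf (joint (channel_transform l g V b)) z"
  proof (cases "length ys = l \<and> length us = b")
    case False
    then have "S = {}" using gU b by (auto simp: S_def)
    then show ?thesis
      using False b by (auto simp: z pmf_joint pmf_channel_transform)
  next
    case True
    \<comment> \<open>\<open>Z ws\<close> is the only block with outputs \<open>ys\<close> whose
      kernel argument is \<open>us\<close>, \<open>a\<close>, \<open>ws\<close>. So the event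
      \<open>S\<close> is indexed by the tails that the transform sums over.\<close>
    define Z where "Z = (\<lambda>ws. zip (g (us @ [a] @ ws)) ys)"
    have len: "length (g (us @ [a] @ ws)) = l" if "length ws = l - 1 - b" for ws
      using bij_betw_apply[OF g, of "us @ [a] @ ws"] that True b by simp
    have "S = Z ` {ws. length ws = l - 1 - b}"
    proof (intro equalityI subsetI)
      fix zs assume zs: "zs \<in> S"
      then have *: "length zs = l" "U zs ! b = a" "map snd zs = ys" "take b (U zs) = us"
        by (auto simp: S_def)
      have "U zs = us @ [a] @ drop (Suc b) (U zs)"
        using * gU[OF *(1)] b by (metis append_Cons append_Nil id_take_nth_drop)
      then have "zs = Z (drop (Suc b) (U zs))"
        using *(3) gU(1)[OF *(1)] by (metis Z_def zip_map_fst_snd)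
      then show "zs \<in> Z ` {ws. length ws = l - 1 - b}"
        using gU(2)[OF *(1)] by auto
    next
      fix zs assume "zs \<in> Z ` {ws. length ws = l - 1 - b}"
      then obtain ws where ws: "length ws = l - 1 - b" "zs = zip (g (us @ [a] @ ws)) ys"
        by (auto simp: Z_def)
      then have "U zs = us @ [a] @ ws"
        using Ug[of "us @ [a] @ ws"] True b by simp
      then show "zs \<in> S"
        using ws len[OF ws(1)] True by (auto simp: S_def nth_append)
    qed
    moreover have inj: "inj_on Z {ws. length ws = l - 1 - b}"
    proof (rule inj_on_inverseI)
      show "drop (Suc b) (U (Z ws)) = ws" if "ws \<in> {ws. length ws = l - 1 - b}" for ws
        using that True b Ug[of "us @ [a] @ ws"] by (simp add: Z_def)
    qed
    moreover have "finite {ws::'x list. length ws = l - 1 - b}"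
      using finite_lists_length_eq[of "UNIV::'x set"] by simp
    ultimately have "measure_pmf.prob (block l V) S = (\<Sum>ws | length ws = l - 1 - b. pmf (block l V) (Z ws))"
      by (simp add: measure_measure_pmf_finite sum.reindex)
    also have "\<dots> = (\<Sum>ws | length ws = l - 1 - b. 1 / q ^ l * (\<Prod>k<l. pmf (V (g (us @ [a] @ ws) ! k)) (ys ! k)))"
    proof (intro sum.cong refl)
      fix ws :: "'x list" assume "ws \<in> {ws. length ws = l - 1 - b}"
      then show "pmf (block l V) (Z ws) = 1 / q ^ l * (\<Prod>k<l. pmf (V (g (us @ [a] @ ws) ! k)) (ys ! k))"
        using len[of ws] True by (simp add: Z_def block_def pmf_list_pmf pmf_joint prod_dividef q_def)
    qed
    \<comment> \<open>Of the \<open>l\<close> factors \<open>1 / q\<close>, one is the uniform input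
      of the joint law and \<open>l - 1\<close> are the normalisation of the transform.\<close>
    also have "\<dots> = pmf (joint (channel_transform l g V b)) z"
      using b True by (cases l) (simp_all add: z pmf_joint pmf_channel_transform q_def sum_divide_distrib mult.commute[of "real CARD('x)" "_ ^ _"])
    finally show ?thesis .
  qed
  finally show "pmf (joint (channel_transform l g V b)) z =
     pmf (map_pmf (\<lambda>zs. (U zs ! b, (map snd zs, take b (U zs)))) (block l V)) z" ..
qed

text \<open>The transforms uncover the coordinates of \<open>U zs\<close> one at a time with the
  outputs given, so their entropies add up to that of the whole of \<open>U zs\<close>. Since
  \<open>g\<close> is a bijection, this is the entropy of the inputs of \<open>l\<close> independent
  uses.\<close>

lemma channel_entropy_conservation:
  fixes V :: "'x::finite \<Rightarrow> 'o pmf"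
  assumes g: "bij_betw g {v. length v = l} {v. length v = l}"
  shows "(\<Sum>b<l. channel_entropy (channel_transform l g V b)) = of_nat l * channel_entropy V"
proof -
  define U where "U = (\<lambda>zs::('x \<times> 'o) list. inv_into {v. length v = l} g (map fst zs))"
  have U: "g (U zs) = map fst zs" "length (U zs) = l" if "zs \<in> set_pmf (block l V)" for zs
    using length_block[OF that] bij_betw_inv_into_right[OF g, of "map fst zs"]
      bij_betw_apply[OF bij_betw_inv_into[OF g], of "map fst zs"]
    by (simp_all add: U_def)
  have "(\<Sum>b<k. channel_entropy (channel_transform l g V b)) =
      cond_entropy (block l V) (\<lambda>zs. take k (U zs)) (map snd)" if "k \<le> l" for k
    using that
  proof (induction k)
    case 0
    have "level_prob (block l V) (\<lambda>zs. ([] :: 'x list, map snd zs)) zs = level_prob (block l V) (map snd) zs" for zs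
      by (rule level_prob_cong) simp
    then show ?case
      by (simp add: cond_entropy_def level_prob_pos AE_measure_pmf_iff nn_integral_0_iff_AE less_imp_neq[symmetric])
  next
    case (Suc k)
    have "channel_entropy (channel_transform l g V k) =
        cond_entropy (block l V) (\<lambda>zs. U zs ! k) (\<lambda>zs. (map snd zs, take k (U zs)))"
      using Suc.prems by (simp add: channel_entropy_def joint_channel_transform[OF g] cond_entropy_map U_def)
    moreover have "cond_entropy (block l V) (\<lambda>zs. take (Suc k) (U zs)) (map snd) =
        cond_entropy (block l V) (\<lambda>zs. (take k (U zs), U zs ! k)) (map snd)"
      using U Suc.prems by (intro cond_entropy_cong) (auto simp: take_Suc_conv_app_nth)
    ultimately show ?case
      using Suc by (simp add: cond_entropy_chain)
  qed
  then have "(\<Sum>b<l. channel_entropy (channel_transform l g V b)) =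
      cond_entropy (block l V) (\<lambda>zs. take l (U zs)) (map snd)" by simp
  also have "\<dots> = cond_entropy (block l V) (map fst) (map snd)"
    using U by (intro cond_entropy_cong) (simp, metis U_def order_refl take_all)
  finally show ?thesis
    by (simp add: block_def cond_entropy_list_pmf channel_entropy_def)
qed

section \<open>The entropy gain of the last transformed channel\<close>

lemma ennreal_bhattacharyya:
  "ennreal (bhattacharyya V x x') = (\<integral>\<^sup>+y. ennreal (sqrt (pmf (V x) y * pmf (V x') y)) \<partial>count_space UNIV)"
proof -
  have "Infinite_Set_Sum.abs_summable_on (\<lambda>y. sqrt (pmf (V x) y * pmf (V x') y)) UNIV"
    using summable_bhattacharyya[of V x x'] by (simp flip: abs_summable_equivalent)
  then show ?thesis
    by (simp add: bhattacharyya_def nn_integral_conv_infsetsum infsetsum_infsum)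
qed

lemma bhattacharyya_nonneg: "0 \<le> bhattacharyya V x x'"
  by (simp add: bhattacharyya_def infsum_nonneg)

text \<open>Expanding the square leaves the two total masses. The additive form makes sense in
  \<open>ennreal\<close> before the parameter is known to be at most 1, a bound which is then read
  off from it.\<close>

lemma hellinger_bhattacharyya:
  "(\<integral>\<^sup>+y. ennreal ((sqrt (pmf (V x) y) - sqrt (pmf (V x') y))\<^sup>2) \<partial>count_space UNIV) +
     2 * ennreal (bhattacharyya V x x') = 2"
proof -
  have "ennreal ((sqrt (pmf (V x) y) - sqrt (pmf (V x') y))\<^sup>2) + 2 * ennreal (sqrt (pmf (V x) y * pmf (V x') y)) =
      ennreal (pmf (V x) y) + ennreal (pmf (V x') y)" for y
  proof -
    have "ennreal ((sqrt (pmf (V x) y) - sqrt (pmf (V x') y))\<^sup>2) + 2 * ennreal (sqrt (pmf (V x) y * pmf (V x') y)) =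
      ennreal ((sqrt (pmf (V x) y) - sqrt (pmf (V x') y))\<^sup>2 + 2 * sqrt (pmf (V x) y * pmf (V x') y))"
      by (simp add: ennreal_mult)
    also have "(sqrt (pmf (V x) y) - sqrt (pmf (V x') y))\<^sup>2 + 2 * sqrt (pmf (V x) y * pmf (V x') y) =
      pmf (V x) y + pmf (V x') y"
      by (simp add: power2_diff real_sqrt_mult)
    finally show ?thesis by simp
  qed
  then have "(\<integral>\<^sup>+y. ennreal ((sqrt (pmf (V x) y) - sqrt (pmf (V x') y))\<^sup>2) +
        2 * ennreal (sqrt (pmf (V x) y * pmf (V x') y)) \<partial>count_space UNIV) =
      (\<integral>\<^sup>+y. ennreal (pmf (V x) y) + ennreal (pmf (V x') y) \<partial>count_space UNIV)"
    by (intro nn_integral_cong)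
  then show ?thesis
    by (simp add: nn_integral_add nn_integral_cmult ennreal_bhattacharyya nn_integral_pmf_eq_1)
qed

lemma bhattacharyya_le_1: "bhattacharyya V x x' \<le> 1"
proof -
  have "2 * ennreal (bhattacharyya V x x') \<le> 2"
    by (subst (2) hellinger_bhattacharyya[of V x x', symmetric]) simp
  then have "ennreal (2 * bhattacharyya V x x') \<le> ennreal 2"
    by (simp add: ennreal_mult bhattacharyya_nonneg)
  then show ?thesis by (subst (asm) ennreal_le_iff) auto
qed

lemma nn_integral_hellinger:
  "(\<integral>\<^sup>+y. ennreal ((sqrt (pmf (V x) y) - sqrt (pmf (V x') y))\<^sup>2) \<partial>count_space UNIV) =
     ennreal (2 * (1 - bhattacharyya V x x'))" (is "?I = _")
proof -
  have "?I + ennreal (2 * bhattacharyya V x x') = ennreal (2 * (1 - bhattacharyya V x x')) + ennreal (2 * bhattacharyya V x x')"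
    using hellinger_bhattacharyya[of V x x'] bhattacharyya_nonneg[of V x x'] bhattacharyya_le_1[of V x x']
    by (subst ennreal_plus[symmetric]) (simp_all add: ennreal_mult)
  then show ?thesis
    by (simp add: add.commute[of _ "ennreal (2 * bhattacharyya V x x')"] ennreal_add_left_cancel)
qed

text \<open>Cauchy-Schwarz for the square roots of minimum and maximum, where the sum of the maxima
  is at most 2. The common mass of the two output laws, on which one use can confuse the inputs, is
  thus at least Z^2 / 2.\<close>

lemma bhattacharyya_le_min:
  "ennreal ((bhattacharyya V x x')\<^sup>2) \<le> 2 * (\<integral>\<^sup>+y. ennreal (min (pmf (V x) y) (pmf (V x') y)) \<partial>count_space UNIV)"
proof -
  define f where "f = (\<lambda>y. min (pmf (V x) y) (pmf (V x') y))"
  define h where "h = (\<lambda>y. max (pmf (V x) y) (pmf (V x') y))"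
  have nn: "f y \<ge> 0" "h y \<ge> 0" for y by (simp_all add: f_def h_def le_max_iff_disj)
  have fh: "f y * h y = pmf (V x) y * pmf (V x') y" for y
    by (simp add: f_def h_def min_def max_def)
  have "ennreal ((bhattacharyya V x x')\<^sup>2) = (\<integral>\<^sup>+y. ennreal (sqrt (f y)) * ennreal (sqrt (h y)) \<partial>count_space UNIV)\<^sup>2"
    by (simp add: ennreal_power[symmetric] bhattacharyya_nonneg ennreal_bhattacharyya nn fh
        flip: ennreal_mult real_sqrt_mult)
  also have "\<dots> \<le> (\<integral>\<^sup>+y. (ennreal (sqrt (f y)))\<^sup>2 \<partial>count_space UNIV) * (\<integral>\<^sup>+y. (ennreal (sqrt (h y)))\<^sup>2 \<partial>count_space UNIV)"
    by (rule Cauchy_Schwarz_nn_integral) auto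
  also have "\<dots> = (\<integral>\<^sup>+y. ennreal (f y) \<partial>count_space UNIV) * (\<integral>\<^sup>+y. ennreal (h y) \<partial>count_space UNIV)"
    by (simp add: ennreal_power nn)
  also have "\<dots> \<le> (\<integral>\<^sup>+y. ennreal (f y) \<partial>count_space UNIV) * 2"
  proof (intro mult_left_mono)
    have "(\<integral>\<^sup>+y. ennreal (h y) \<partial>count_space UNIV) \<le> (\<integral>\<^sup>+y. ennreal (pmf (V x) y) + ennreal (pmf (V x') y) \<partial>count_space UNIV)"
      by (intro nn_integral_mono) (auto simp: h_def max_def simp flip: ennreal_plus intro!: ennreal_leI)
    also have "\<dots> = 2"
      by (simp add: nn_integral_add nn_integral_pmf_eq_1)
    finally show "(\<integral>\<^sup>+y. ennreal (h y) \<partial>count_space UNIV) \<le> 2" .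
  qed simp
  finally show ?thesis
    by (simp add: f_def mult.commute)
qed

text \<open>No reference point \<theta> is close to both \<alpha> and \<beta>. It will be the root
  of a conditional probability, and the bound has to be free of it.\<close>

lemma min_times_square_diff_le:
  fixes w w' \<alpha> \<beta> \<theta> :: real
  assumes "0 \<le> w" "0 \<le> w'"
  shows "min w w' / 2 * (\<alpha> - \<beta>)\<^sup>2 \<le> w * (\<alpha> - \<theta>)\<^sup>2 + w' * (\<beta> - \<theta>)\<^sup>2"
proof -
  have "(\<alpha> - \<beta>)\<^sup>2 \<le> 2 * ((\<alpha> - \<theta>)\<^sup>2 + (\<beta> - \<theta>)\<^sup>2)"
    using zero_le_power2[of "(\<alpha> - \<theta>) + (\<beta> - \<theta>)"] by (simp add: power2_eq_square algebra_simps)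
  then have "min w w' / 2 * (\<alpha> - \<beta>)\<^sup>2 \<le> min w w' / 2 * (2 * ((\<alpha> - \<theta>)\<^sup>2 + (\<beta> - \<theta>)\<^sup>2))"
    using assms by (intro mult_left_mono) auto
  also have "\<dots> = min w w' * (\<alpha> - \<theta>)\<^sup>2 + min w w' * (\<beta> - \<theta>)\<^sup>2"
    by (simp add: algebra_simps)
  also have "\<dots> \<le> w * (\<alpha> - \<theta>)\<^sup>2 + w' * (\<beta> - \<theta>)\<^sup>2"
    by (intro add_mono mult_right_mono) auto
  finally show ?thesis .
qed

section \<open>The last transform and its observed prefix\<close>

text \<open>The probability of an independent observation is a common factor of both level
  probabilities and cancels. The uniform prefix will be such an observation.\<close>

lemma cond_entropy_pair_pmf:
  fixes A :: "'a pmf" and p :: "'b pmf"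
  shows "cond_entropy (pair_pmf A p) (\<lambda>z. X (snd z)) (\<lambda>z. (fst z, Y (snd z))) = cond_entropy p X Y"
proof -
  have lp: "level_prob (pair_pmf A p) (\<lambda>z. (fst z, F (snd z))) z = pmf A (fst z) * level_prob p F (snd z)"
    for F :: "'b \<Rightarrow> 'e" and z
  proof -
    have "map_pmf (\<lambda>z. (fst z, F (snd z))) (pair_pmf A p) = pair_pmf A (map_pmf F p)"
      by (simp add: pair_map_pmf2 apsnd_def map_prod_def case_prod_unfold)
    then show ?thesis by (simp add: level_prob_def pmf_pair)
  qed
  have lp': "level_prob (pair_pmf A p) (\<lambda>z. (X (snd z), (fst z, Y (snd z)))) z =
      pmf A (fst z) * level_prob p (\<lambda>s. (X s, Y s)) (snd z)" for z
  proof -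
    have "level_prob (pair_pmf A p) (\<lambda>z. (X (snd z), (fst z, Y (snd z)))) z =
        level_prob (pair_pmf A p) (\<lambda>z. (fst z, (X (snd z), Y (snd z)))) z"
      by (rule level_prob_cong) auto
    then show ?thesis using lp[of "\<lambda>s. (X s, Y s)"] by simp
  qed
  have "cond_entropy (pair_pmf A p) (\<lambda>z. X (snd z)) (\<lambda>z. (fst z, Y (snd z))) =
    (\<integral>\<^sup>+z. ennreal (- ln (level_prob p (\<lambda>s. (X s, Y s)) (snd z) / level_prob p Y (snd z))) \<partial>measure_pmf (pair_pmf A p))"
    unfolding cond_entropy_def lp lp'
    by (intro nn_integral_cong_AE) (auto simp: AE_measure_pmf_iff set_pmf_iff)
  also have "\<dots> = (\<integral>\<^sup>+s. ennreal (- ln (level_prob p (\<lambda>s. (X s, Y s)) s / level_prob p Y s))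
      \<partial>measure_pmf (map_pmf snd (pair_pmf A p)))"
    by (simp only: nn_integral_map_pmf)
  finally show ?thesis by (simp add: map_snd_pair_pmf cond_entropy_def)
qed

text \<open>At the last index no input is left to sum over: the prefix \<open>v\<close> is drawn
  uniformly and handed to the receiver, and given \<open>v\<close> and \<open>a\<close> the outputs
  are independent.\<close>

lemma joint_channel_transform_last:
  fixes V :: "'x::finite \<Rightarrow> 'o pmf"
  assumes "l > 0"
  shows "joint (channel_transform l g V (l - 1)) =
    bind_pmf (pmf_of_set {v. length v = l - 1}) (\<lambda>v. bind_pmf (pmf_of_set UNIV) (\<lambda>a.
      map_pmf (\<lambda>ys. (a, (ys, v))) (list_pmf (map (\<lambda>k. V (g (v @ [a]) ! k)) [0..<l]))))"
proof -
  let ?L = "{v :: 'x list. length v = l - 1}"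
  have L: "finite ?L" "?L \<noteq> {}" "card ?L = CARD('x) ^ (l - 1)"
    using finite_lists_length_eq[of "UNIV::'x set" "l - 1"] card_lists_length_eq[of "UNIV::'x set" "l - 1"]
      Ex_list_of_length[of "l - 1"] by auto
  define P where "P = (\<lambda>v a. list_pmf (map (\<lambda>k. V (g (v @ [a]) ! k)) [0..<l]))"
  have "channel_transform l g V (l - 1) a = bind_pmf (pmf_of_set ?L) (\<lambda>v. map_pmf (\<lambda>ys. (ys, v)) (P v a))" for a
  proof (rule pmf_eqI)
    fix z :: "'o list \<times> 'x list"
    obtain ys us where z: "z = (ys, us)" by (cases z)
    have "pmf (map_pmf (\<lambda>ys. (ys, v)) (P v a)) (ys, us) = (if v = us then pmf (P us a) ys else 0)" for v
      using pmf_map_inj'[of "\<lambda>ys. (ys, v)" "P v a" ys] by (auto simp: inj_on_def pmf_eq_0_set_pmf)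
    then have "pmf (bind_pmf (pmf_of_set ?L) (\<lambda>v. map_pmf (\<lambda>ys. (ys, v)) (P v a))) z =
       (if length us = l - 1 then pmf (P us a) ys else 0) / real CARD('x) ^ (l - 1)"
      using L by (simp add: z pmf_bind_pmf_of_set)
    also have "\<dots> = pmf (channel_transform l g V (l - 1) a) z"
      using assms by (simp add: z pmf_channel_transform P_def pmf_list_pmf)
    finally show "pmf (channel_transform l g V (l - 1) a) z =
      pmf (bind_pmf (pmf_of_set ?L) (\<lambda>v. map_pmf (\<lambda>ys. (ys, v)) (P v a))) z" ..
  qed
  then show ?thesis
    unfolding joint_def P_def
    by (simp add: map_bind_pmf map_pmf_comp bind_commute_pmf[of "pmf_of_set (UNIV::'x set)"])
qed

lemma map_list_pmf_nth_pair:
  assumes "i < l" "j < l" "i \<noteq> j"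
  shows "map_pmf (\<lambda>ys. F (ys ! i) (ys ! j)) (list_pmf (map P [0..<l])) =
    map_pmf (\<lambda>(y, y'). F y y') (pair_pmf (P i) (P j))"
  using map_nth_pair_list_pmf[of i "map P [0..<l]" j] assms
  by (simp flip: map_pmf_comp[of "\<lambda>(y, y'). F y y'" "\<lambda>ys. (ys ! i, ys ! j)", simplified])

lemma map_list_pmf_nth:
  assumes "i < l"
  shows "map_pmf (\<lambda>ys. F (ys ! i)) (list_pmf (map P [0..<l])) = map_pmf F (P i)"
  using map_nth_list_pmf[of i "map P [0..<l]"] assms
  by (simp flip: map_pmf_comp[of F "\<lambda>ys. ys ! i"])

text \<open>The receiver is weakened first to see only the prefix \<open>v\<close> and the outputs
  at \<open>m v\<close> and \<open>j\<close> (\<open>P1\<close>), then to lose the output at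
  \<open>j\<close> (\<open>P2\<close>). The last receiver has exactly the entropy of one use of
  \<open>V\<close>. Losing the output at \<open>j\<close> costs a Hellinger term, of which only the
  samples with prefix \<open>u\<close> and input \<open>a\<close> or \<open>b\<close> are kept. The
  constant collects \<open>1 / q ^ l\<close> from prefix and input, 1/2 from
  \<open>min_times_square_diff_le\<close>, 1/2 from \<open>bhattacharyya_le_min\<close> and 2 from
  \<open>nn_integral_hellinger\<close>.\<close>

lemma channel_entropy_gain:
  fixes V :: "'x::finite \<Rightarrow> 'o pmf"
  assumes u: "length u = l - 1"
    and ij: "i < l" "j < l" "i \<noteq> j"
    and bij: "bij \<sigma>"
    and g_u: "\<forall>a. g (u @ [a]) ! i = \<sigma> a \<and> g (u @ [a]) ! j = \<tau> a"
    and g_v: "\<forall>v. length v = l - 1 \<and> v \<noteq> u \<longrightarrow>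
      (\<exists>m<l. \<exists>\<mu>. bij \<mu> \<and> (\<forall>a. g (v @ [a]) ! m = \<mu> a))"
  shows "channel_entropy (channel_transform l g V (l - 1)) +
     ennreal ((bhattacharyya V (\<sigma> a) (\<sigma> b))\<^sup>2 * (1 - bhattacharyya V (\<tau> a) (\<tau> b)) / (2 * real CARD('x) ^ l))
     \<le> channel_entropy V"
proof -
  let ?L = "{v :: 'x list. length v = l - 1}"
  have l: "l > 0" using ij by simp
  have L: "finite ?L" "?L \<noteq> {}" "card ?L = CARD('x) ^ (l - 1)"
    using finite_lists_length_eq[of "UNIV::'x set" "l - 1"] card_lists_length_eq[of "UNIV::'x set" "l - 1"]
      Ex_list_of_length[of "l - 1"] by auto
  have setL: "set_pmf (pmf_of_set ?L) = ?L" using L(2,1) by (rule set_pmf_of_set)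
  define q where "q = real CARD('x)"
  have q: "q > 0" by (simp add: q_def)
  have ql: "q ^ l = q * q ^ (l - 1)" using l by (cases l) auto
  \<comment> \<open>For \<open>v = u\<close> the choice is pinned to \<open>i\<close> and \<sigma>,
    so that \<open>j\<close> remains as a second, different use.\<close>
  have "\<exists>m \<mu>. v \<in> ?L \<longrightarrow> m < l \<and> bij \<mu> \<and> (\<forall>a. g (v @ [a]) ! m = \<mu> a) \<and> (v = u \<longrightarrow> m = i \<and> \<mu> = \<sigma>)" for v
    using g_u g_v ij bij by (cases "v = u") auto
  then obtain m \<mu> where m: "\<And>v. v \<in> ?L \<Longrightarrow> m v < l" and \<mu>: "\<And>v. v \<in> ?L \<Longrightarrow> bij (\<mu> v)"
    and g\<mu>: "\<And>v a. v \<in> ?L \<Longrightarrow> g (v @ [a]) ! m v = \<mu> v a" and mu: "m u = i" "\<mu> u = \<sigma>"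
    using u by (simp add: choice_iff) metis
  define P where "P = joint (channel_transform l g V (l - 1))"
  define P1 where "P1 = map_pmf (\<lambda>(a, (ys, v)). (a, (v, (ys ! m v, ys ! j)))) P"
  define P2 where "P2 = map_pmf (\<lambda>(a, (v, (y, y'))). (a, (v, y))) P1"
  define Q where "Q = (\<lambda>v a. list_pmf (map (\<lambda>k. V (g (v @ [a]) ! k)) [0..<l]))"
  have P: "P = bind_pmf (pmf_of_set ?L) (\<lambda>v. bind_pmf (pmf_of_set UNIV) (\<lambda>a. map_pmf (\<lambda>ys. (a, (ys, v))) (Q v a)))"
    unfolding P_def Q_def by (rule joint_channel_transform_last[OF l])
  have P1: "P1 = bind_pmf (pmf_of_set ?L) (\<lambda>v. bind_pmf (pmf_of_set UNIV) (\<lambda>a.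
      map_pmf (\<lambda>ys. (a, (v, (ys ! m v, ys ! j)))) (Q v a)))"
    by (simp add: P1_def P map_bind_pmf map_pmf_comp)
  have "P2 = bind_pmf (pmf_of_set ?L) (\<lambda>v. bind_pmf (pmf_of_set UNIV) (\<lambda>a.
      map_pmf (\<lambda>ys. (a, (v, ys ! m v))) (Q v a)))"
    by (simp add: P2_def P1 map_bind_pmf map_pmf_comp)
  also have "\<dots> = bind_pmf (pmf_of_set ?L) (\<lambda>v. bind_pmf (pmf_of_set UNIV) (\<lambda>a.
      map_pmf (\<lambda>y. (a, (v, y))) (V (\<mu> v a))))"
  proof (intro bind_pmf_cong refl)
    fix v a assume "v \<in> set_pmf (pmf_of_set ?L)"
    then have v: "v \<in> ?L" by (simp only: setL)
    show "map_pmf (\<lambda>ys. (a, (v, ys ! m v))) (Q v a) = map_pmf (\<lambda>y. (a, (v, y))) (V (\<mu> v a))"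
      using map_list_pmf_nth[OF m[OF v], of "\<lambda>y. (a, (v, y))" "\<lambda>k. V (g (v @ [a]) ! k)"]
      by (simp add: Q_def g\<mu>[OF v])
  qed
  finally have P2: "P2 = bind_pmf (pmf_of_set ?L) (\<lambda>v. bind_pmf (pmf_of_set UNIV) (\<lambda>a.
      map_pmf (\<lambda>y. (a, (v, y))) (V (\<mu> v a))))" .
  \<comment> \<open>With its Hellinger term discarded, \<open>cond_entropy_factor\<close> says that
    passing to a function of the observation cannot lower the entropy.\<close>
  have ent1: "channel_entropy (channel_transform l g V (l - 1)) \<le> cond_entropy P1 fst snd"
  proof -
    have "cond_entropy P fst snd \<le> cond_entropy P fst (\<lambda>z. (\<lambda>(ys, v). (v, (ys ! m v, ys ! j))) (snd z))"
      by (rule order.trans[OF _ cond_entropy_factor]) simp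
    also have "\<dots> = cond_entropy P1 fst snd"
      by (simp add: P1_def cond_entropy_map case_prod_unfold)
    finally show ?thesis by (simp add: P_def channel_entropy_def)
  qed
  have ent2: "cond_entropy P1 fst (\<lambda>z. (\<lambda>(v, (y, y')). (v, y)) (snd z)) = channel_entropy V"
  proof -
    \<comment> \<open>Substituting \<open>x = \<mu> v a\<close> keeps the input uniform, so the
      prefix and the channel use become independent.\<close>
    have P2': "P2 = map_pmf (\<lambda>(v, (x, y)). (inv (\<mu> v) x, (v, y))) (pair_pmf (pmf_of_set ?L) (joint V))"
    proof -
      have "bind_pmf (pmf_of_set UNIV) (\<lambda>a. map_pmf (\<lambda>y. (a, (v, y))) (V (\<mu> v a))) =
          bind_pmf (pmf_of_set UNIV) (\<lambda>x. map_pmf (\<lambda>y. (inv (\<mu> v) x, (v, y))) (V x))" if "v \<in> ?L" for v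
      proof -
        have "bind_pmf (pmf_of_set UNIV) (\<lambda>x. map_pmf (\<lambda>y. (inv (\<mu> v) x, (v, y))) (V x)) =
          bind_pmf (map_pmf (\<mu> v) (pmf_of_set UNIV)) (\<lambda>x. map_pmf (\<lambda>y. (inv (\<mu> v) x, (v, y))) (V x))"
          using \<mu>[OF that] by (subst map_pmf_of_set_bij_betw) auto
        also have "\<dots> = bind_pmf (pmf_of_set UNIV) (\<lambda>a. map_pmf (\<lambda>y. (a, (v, y))) (V (\<mu> v a)))"
          using \<mu>[OF that] by (simp add: bind_map_pmf bij_is_inj)
        finally show ?thesis ..
      qed
      then have "P2 = bind_pmf (pmf_of_set ?L) (\<lambda>v. bind_pmf (pmf_of_set UNIV) (\<lambda>x.
          map_pmf (\<lambda>y. (inv (\<mu> v) x, (v, y))) (V x)))"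
        unfolding P2 by (rule bind_pmf_cong[OF refl]) (simp only: setL)
      also have "\<dots> = map_pmf (\<lambda>(v, (x, y)). (inv (\<mu> v) x, (v, y))) (pair_pmf (pmf_of_set ?L) (joint V))"
        by (simp add: pair_pmf_def joint_def map_bind_pmf bind_assoc_pmf bind_map_pmf bind_return_pmf map_pmf_def)
      finally show ?thesis .
    qed
    have "cond_entropy P1 fst (\<lambda>z. (\<lambda>(v, (y, y')). (v, y)) (snd z)) = cond_entropy P2 fst snd"
      by (simp add: P2_def cond_entropy_map case_prod_unfold)
    also have "\<dots> = cond_entropy (pair_pmf (pmf_of_set ?L) (joint V)) (\<lambda>z. fst (snd z)) (\<lambda>z. (fst z, snd (snd z)))"
      unfolding P2' cond_entropy_map
    proof (rule cond_entropy_cong, goal_cases)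
      case (2 s t)
      from 2(1) have "fst s \<in> ?L"
        by (cases s) (simp only: set_pair_pmf mem_Sigma_iff fst_conv setL)
      then have "inj (inv (\<mu> (fst s)))"
        by (intro bij_is_inj bij_imp_bij_inv \<mu>)
      with 2(3) show ?case by (simp add: case_prod_unfold inj_eq)
    qed (auto simp: case_prod_unfold)
    also have "\<dots> = channel_entropy V"
      unfolding channel_entropy_def by (rule cond_entropy_pair_pmf)
    finally show ?thesis .
  qed
  \<comment> \<open>At a point with prefix \<open>u\<close> and input \<open>c\<close> a single pair
    \<open>(v, a)\<close> contributes, drawn with probability \<open>1 / q ^ l\<close>.\<close>
  have pmf_sample: "pmf (bind_pmf (pmf_of_set ?L) (\<lambda>v. bind_pmf (pmf_of_set UNIV) (F v))) z = K / q ^ l"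
    if F: "\<And>v a. v \<in> ?L \<Longrightarrow> pmf (F v a) z = (if v = u then if a = c then K else 0 else 0)"
    for F :: "'x list \<Rightarrow> 'x \<Rightarrow> 'z pmf" and z K c
  proof -
    have "pmf (bind_pmf (pmf_of_set UNIV) (F v)) z = (if v = u then K / q else 0)" if "v \<in> ?L" for v
      by (simp only: pmf_bind_pmf_of_set[OF UNIV_not_empty finite] F[OF that])
        (simp add: q_def)
    then have "pmf (bind_pmf (pmf_of_set ?L) (\<lambda>v. bind_pmf (pmf_of_set UNIV) (F v))) z =
        (\<Sum>v\<in>?L. if v = u then K / q else 0) / real (card ?L)"
      by (subst pmf_bind_pmf_of_set[OF L(2,1)]) simp
    also have "\<dots> = K / q / q ^ (l - 1)"
      using L(1) u by (simp add: L(3)[simplified] q_def)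
    finally show ?thesis by (simp add: ql)
  qed
  have pmf1: "pmf P1 (c, (u, (y, y'))) = pmf (V (\<sigma> c)) y * pmf (V (\<tau> c)) y' / q ^ l" for c y y'
  proof -
    have "pmf (map_pmf (\<lambda>ys. (a, (v, (ys ! m v, ys ! j)))) (Q v a)) (c, (u, (y, y'))) =
        (if v = u then if a = c then pmf (V (\<sigma> c)) y * pmf (V (\<tau> c)) y' else 0 else 0)" if "v \<in> ?L" for v a
    proof (cases "v = u \<and> a = c")
      case True
      then have "map_pmf (\<lambda>ys. (a, (v, (ys ! m v, ys ! j)))) (Q v a) =
          map_pmf (\<lambda>z. (c, (u, z))) (pair_pmf (V (\<sigma> c)) (V (\<tau> c)))"
        using ij g_u mu
        by (simp add: Q_def map_list_pmf_nth_pair[where F = "\<lambda>y y'. (_, (_, (y, y')))"] case_prod_unfold)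
      then show ?thesis
        using True pmf_map_inj'[of "\<lambda>z. (c, (u, z))" "pair_pmf (V (\<sigma> c)) (V (\<tau> c))" "(y, y')"]
        by (simp add: inj_on_def pmf_pair)
    qed (auto simp: pmf_eq_0_set_pmf)
    then show ?thesis
      unfolding P1 by (rule pmf_sample)
  qed
  have pmf2: "pmf P2 (c, (u, y)) = pmf (V (\<sigma> c)) y / q ^ l" for c y
  proof -
    have "pmf (map_pmf (\<lambda>y. (a, (v, y))) (V (\<mu> v a))) (c, (u, y)) =
        (if v = u then if a = c then pmf (V (\<sigma> c)) y else 0 else 0)" for v a
      using pmf_map_inj'[of "\<lambda>y. (a, (v, y))" "V (\<mu> v a)" y] mu
      by (auto simp: inj_on_def pmf_eq_0_set_pmf)
    then show ?thesis
      unfolding P2 by (rule pmf_sample)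
  qed
  \<comment> \<open>The comparison law of \<open>cond_entropy_factor\<close> for the function that
    forgets the output at \<open>j\<close>.\<close>
  define r where "r = (\<lambda>(a, b). pmf (map_pmf snd P1) b *
    (pmf (map_pmf (\<lambda>(a, b). (a, (\<lambda>(v, (y, y')). (v, y)) b)) P1) (a, (\<lambda>(v, (y, y')). (v, y)) b) /
       pmf (map_pmf (\<lambda>(a, b). (\<lambda>(v, (y, y')). (v, y)) b) P1) ((\<lambda>(v, (y, y')). (v, y)) b)))"
  \<comment> \<open>The conditional probability of the second output given \<open>u\<close> and the
    first output. It does not involve the input, so \<open>a\<close> and \<open>b\<close> are
    compared with the same value.\<close>
  define T where "T = (\<lambda>y y'. pmf (map_pmf snd P1) (u, (y, y')) /
     pmf (map_pmf (\<lambda>(a, b). (\<lambda>(v, (y, y')). (v, y)) b) P1) (u, y))"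
  have r: "r (c, (u, (y, y'))) = pmf (V (\<sigma> c)) y / q ^ l * T y y'" for c y y'
    using pmf2[of c y] by (simp add: r_def T_def P2_def case_prod_unfold)
  define D where "D = (\<lambda>z. ennreal ((sqrt (pmf P1 z) - sqrt (r z))\<^sup>2))"
  have gain: "cond_entropy P1 fst snd + (\<integral>\<^sup>+z. D z \<partial>count_space UNIV) \<le> channel_entropy V"
    unfolding D_def r_def ent2[symmetric] by (rule cond_entropy_factor)
  have "ennreal ((bhattacharyya V (\<sigma> a) (\<sigma> b))\<^sup>2 * (1 - bhattacharyya V (\<tau> a) (\<tau> b)) / (2 * q ^ l)) \<le>
      (\<integral>\<^sup>+z. D z \<partial>count_space UNIV)"
  \<comment> \<open>For \<open>a = b\<close> the claimed gain is 0; otherwise \<open>a\<close> and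
    \<open>b\<close> give two different summands over the inputs.\<close>
  proof (cases "a = b")
    case True
    have "bhattacharyya V (\<tau> b) (\<tau> b) = 1"
      using hellinger_bhattacharyya[of V "\<tau> b" "\<tau> b"] bhattacharyya_nonneg[of V "\<tau> b" "\<tau> b"]
        nn_integral_hellinger[of V "\<tau> b" "\<tau> b"] bhattacharyya_le_1[of V "\<tau> b" "\<tau> b"]
      by (simp add: ennreal_eq_0_iff)
    then show ?thesis using True by simp
  next
    case False
    define w where "w = (\<lambda>c y. pmf (V (\<sigma> c)) y)"
    define t where "t = (\<lambda>c y. pmf (V (\<tau> c)) y)"
    have Dc: "D (c, (u, (y, y'))) = ennreal (w c y / q ^ l * (sqrt (t c y') - sqrt (T y y'))\<^sup>2)" for c y y'
    proof -
      have "sqrt (pmf P1 (c, (u, (y, y')))) - sqrt (r (c, (u, (y, y')))) =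
          sqrt (w c y / q ^ l) * (sqrt (t c y') - sqrt (T y y'))"
        by (simp add: pmf1 r w_def t_def real_sqrt_mult real_sqrt_divide diff_divide_distrib algebra_simps)
      then show ?thesis
        using q by (simp add: D_def power_mult_distrib w_def)
    qed
    define E where "E = (\<lambda>y y'. ennreal (min (w a y) (w b y)) * ennreal ((sqrt (t a y') - sqrt (t b y'))\<^sup>2))"
    have DE: "ennreal (1 / (2 * q ^ l)) * E y y' \<le> (\<integral>\<^sup>+c. D (c, (u, (y, y'))) \<partial>count_space UNIV)" for y y'
    proof -
      have "min (w a y) (w b y) / 2 * (sqrt (t a y') - sqrt (t b y'))\<^sup>2 \<le>
          w a y * (sqrt (t a y') - sqrt (T y y'))\<^sup>2 + w b y * (sqrt (t b y') - sqrt (T y y'))\<^sup>2"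
        by (rule min_times_square_diff_le) (simp_all add: w_def)
      then have "min (w a y) (w b y) / 2 * (sqrt (t a y') - sqrt (t b y'))\<^sup>2 / q ^ l \<le>
          (w a y * (sqrt (t a y') - sqrt (T y y'))\<^sup>2 + w b y * (sqrt (t b y') - sqrt (T y y'))\<^sup>2) / q ^ l"
        using q by (intro divide_right_mono) auto
      then have "1 / (2 * q ^ l) * (min (w a y) (w b y) * (sqrt (t a y') - sqrt (t b y'))\<^sup>2) \<le>
          w a y / q ^ l * (sqrt (t a y') - sqrt (T y y'))\<^sup>2 + w b y / q ^ l * (sqrt (t b y') - sqrt (T y y'))\<^sup>2"
        by (simp add: add_divide_distrib)
      then have "ennreal (1 / (2 * q ^ l) * (min (w a y) (w b y) * (sqrt (t a y') - sqrt (t b y'))\<^sup>2)) \<le>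
          ennreal (w a y / q ^ l * (sqrt (t a y') - sqrt (T y y'))\<^sup>2 + w b y / q ^ l * (sqrt (t b y') - sqrt (T y y'))\<^sup>2)"
        by (rule ennreal_leI)
      also have "\<dots> = D (a, (u, (y, y'))) + D (b, (u, (y, y')))"
        unfolding Dc using q by (intro ennreal_plus) (auto simp: w_def)
      also have "ennreal (1 / (2 * q ^ l) * (min (w a y) (w b y) * (sqrt (t a y') - sqrt (t b y'))\<^sup>2)) =
          ennreal (1 / (2 * q ^ l)) * E y y'"
        unfolding E_def using q by (subst ennreal_mult, simp, simp add: w_def, subst ennreal_mult) (auto simp: w_def)
      finally have "ennreal (1 / (2 * q ^ l)) * E y y' \<le> D (a, (u, (y, y'))) + D (b, (u, (y, y')))" .
      also have "\<dots> = (\<Sum>c\<in>{a, b}. D (c, (u, (y, y'))))"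
        using False by simp
      also have "\<dots> \<le> (\<Sum>c\<in>UNIV. D (c, (u, (y, y'))))"
        by (intro sum_mono2) auto
      finally show ?thesis by (simp add: nn_integral_count_space_finite)
    qed
    \<comment> \<open>The 4 makes room for the factor 2 of \<open>nn_integral_hellinger\<close>; the
      2 of \<open>bhattacharyya_le_min\<close> then leads back to
      \<open>1 / (2 * q ^ l)\<close>.\<close>
    have "ennreal ((bhattacharyya V (\<sigma> a) (\<sigma> b))\<^sup>2 * (1 - bhattacharyya V (\<tau> a) (\<tau> b)) / (2 * q ^ l)) =
      ennreal (1 / (4 * q ^ l)) * (ennreal ((bhattacharyya V (\<sigma> a) (\<sigma> b))\<^sup>2) * ennreal (2 * (1 - bhattacharyya V (\<tau> a) (\<tau> b))))"
    proof -
      have "ennreal (A * B / (2 * C)) = ennreal (1 / (4 * C)) * (ennreal A * ennreal (2 * B))"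
        if "A \<ge> 0" "B \<ge> 0" "C > 0" for A B C :: real
        using that by (simp flip: ennreal_mult)
      then show ?thesis using q bhattacharyya_le_1[of V "\<tau> a" "\<tau> b"] by simp
    qed
    also have "\<dots> \<le> ennreal (1 / (4 * q ^ l)) *
       ((2 * (\<integral>\<^sup>+y. ennreal (min (w a y) (w b y)) \<partial>count_space UNIV)) *
        (\<integral>\<^sup>+y'. ennreal ((sqrt (t a y') - sqrt (t b y'))\<^sup>2) \<partial>count_space UNIV))"
      unfolding w_def t_def nn_integral_hellinger
      by (intro mult_left_mono mult_right_mono bhattacharyya_le_min) auto
    also have "\<dots> = ennreal (1 / (4 * q ^ l)) * 2 *
       ((\<integral>\<^sup>+y. ennreal (min (w a y) (w b y)) \<partial>count_space UNIV) *
        (\<integral>\<^sup>+y'. ennreal ((sqrt (t a y') - sqrt (t b y'))\<^sup>2) \<partial>count_space UNIV))"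
      by (simp add: mult_ac)
    also have "ennreal (1 / (4 * q ^ l)) * 2 = ennreal (1 / (2 * q ^ l))"
      using q by (simp flip: ennreal_numeral ennreal_mult)
    also have "(\<integral>\<^sup>+y. ennreal (min (w a y) (w b y)) \<partial>count_space UNIV) *
        (\<integral>\<^sup>+y'. ennreal ((sqrt (t a y') - sqrt (t b y'))\<^sup>2) \<partial>count_space UNIV) =
      (\<integral>\<^sup>+y. \<integral>\<^sup>+y'. E y y' \<partial>count_space UNIV \<partial>count_space UNIV)"
      by (simp add: E_def nn_integral_cmult nn_integral_multc)
    also have "ennreal (1 / (2 * q ^ l)) * \<dots> =
      (\<integral>\<^sup>+y. \<integral>\<^sup>+y'. ennreal (1 / (2 * q ^ l)) * E y y' \<partial>count_space UNIV \<partial>count_space UNIV)"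
      by (simp add: nn_integral_cmult)
    also have "\<dots> \<le> (\<integral>\<^sup>+y. \<integral>\<^sup>+y'. \<integral>\<^sup>+c. D (c, (u, (y, y'))) \<partial>count_space UNIV \<partial>count_space UNIV \<partial>count_space UNIV)"
      by (intro nn_integral_mono DE)
    also have "\<dots> = (\<integral>\<^sup>+z. \<integral>\<^sup>+c. D (c, (u, z)) \<partial>count_space UNIV \<partial>count_space UNIV)"
      by (subst nn_integral_fst_count_space[symmetric]) simp
    \<comment> \<open>Prefixes other than \<open>u\<close> only add nonnegative terms.\<close>
    also have "\<dots> \<le> (\<integral>\<^sup>+v. \<integral>\<^sup>+z. \<integral>\<^sup>+c. D (c, (v, z)) \<partial>count_space UNIV \<partial>count_space UNIV \<partial>count_space UNIV)"
      by (rule nn_integral_ge_point[of u UNIV "\<lambda>v. \<integral>\<^sup>+z. \<integral>\<^sup>+c. D (c, (v, z)) \<partial>count_space UNIV \<partial>count_space UNIV"]) simp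
    also have "\<dots> = (\<integral>\<^sup>+b. \<integral>\<^sup>+c. D (c, b) \<partial>count_space UNIV \<partial>count_space UNIV)"
      by (rule nn_integral_fst_count_space[of "\<lambda>b. \<integral>\<^sup>+c. D (c, b) \<partial>count_space UNIV"])
    also have "\<dots> = (\<integral>\<^sup>+z. D z \<partial>count_space UNIV)"
      by (rule nn_integral_snd_count_space)
    finally show ?thesis .
  qed
  then have "channel_entropy (channel_transform l g V (l - 1)) +
     ennreal ((bhattacharyya V (\<sigma> a) (\<sigma> b))\<^sup>2 * (1 - bhattacharyya V (\<tau> a) (\<tau> b)) / (2 * q ^ l)) \<le>
     cond_entropy P1 fst snd + (\<integral>\<^sup>+z. D z \<partial>count_space UNIV)"
    by (rule add_mono[OF ent1])
  also note gain
  finally show ?thesis by (simp add: q_def)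
qed

section \<open>Random words and polarization\<close>

definition words :: "nat \<Rightarrow> nat \<Rightarrow> nat list set" where
  "words l n = {bs. length bs = n \<and> set bs \<subseteq> {..<l}}"

text \<open>The mean over independent uniform letters. As a finite average it turns the martingale
  argument into sums over words.\<close>

definition word_avg :: "nat \<Rightarrow> nat \<Rightarrow> (nat list \<Rightarrow> real) \<Rightarrow> real" where
  "word_avg l n F = (\<Sum>bs\<in>words l n. F bs) / real l ^ n"

lemma finite_words: "finite (words l n)"
  using finite_lists_length_eq[of "{..<l}" n] by (simp add: words_def conj_commute)

lemma card_words: "card (words l n) = l ^ n"
  using card_lists_length_eq[of "{..<l}" n] by (simp add: words_def conj_commute)

text \<open>Tower property: a longer word is a shorter one followed by an independent uniform
  letter.\<close>

lemma word_avg_Suc: "word_avg l (Suc n) F = word_avg l n (\<lambda>bs. (\<Sum>b<l. F (bs @ [b])) / l)"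
proof -
  have "words l (Suc n) = (\<lambda>(bs, b). bs @ [b]) ` (words l n \<times> {..<l})"
  proof (intro equalityI subsetI)
    fix bs assume "bs \<in> words l (Suc n)"
    then have "bs = butlast bs @ [last bs]" "butlast bs \<in> words l n" "last bs < l"
      by (auto simp: words_def in_set_butlastD intro!: append_butlast_last_id[symmetric] dest: in_set_butlastD)
        (metis Zero_not_Suc last_in_set lessThan_iff list.size(3) subsetD)
    then show "bs \<in> (\<lambda>(bs, b). bs @ [b]) ` (words l n \<times> {..<l})"
      by (intro image_eqI[of _ _ "(butlast bs, last bs)"]) auto
  qed (auto simp: words_def)
  moreover have "inj_on (\<lambda>(bs, b). bs @ [b]) (words l n \<times> {..<l})"
    by (auto simp: inj_on_def)
  ultimately have "(\<Sum>bs\<in>words l (Suc n). F bs) = (\<Sum>bs\<in>words l n. \<Sum>b<l. F (bs @ [b]))"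
    by (simp add: sum.reindex sum.cartesian_product case_prod_unfold)
  then show ?thesis
    by (simp add: word_avg_def sum_divide_distrib[symmetric] divide_divide_eq_left mult.commute)
qed

lemma word_avg_mono: "(\<And>bs. F bs \<le> G bs) \<Longrightarrow> word_avg l n F \<le> word_avg l n G"
  unfolding word_avg_def by (intro divide_right_mono sum_mono) auto

lemma word_avg_const: "l > 0 \<Longrightarrow> word_avg l n (\<lambda>_. c) = c"
  by (simp add: word_avg_def card_words)

lemma word_avg_mult: "word_avg l n (\<lambda>bs. c * F bs) = c * word_avg l n F"
  by (simp add: word_avg_def sum_distrib_left)

lemma word_avg_add: "word_avg l n (\<lambda>bs. F bs + G bs) = word_avg l n F + word_avg l n G"
  by (simp add: word_avg_def sum.distrib add_divide_distrib)

text \<open>The second moment of the martingale \<open>h\<close> is nondecreasing and bounded, so its increments, which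
  dominate the second moment of the gain, tend to zero.\<close>

lemma martingale_gain_tendsto_0:
  fixes h G :: "nat list \<Rightarrow> real"
  assumes l: "d < l"
    and h: "\<And>bs. 0 \<le> h bs" "\<And>bs. h bs \<le> C"
    and avg: "\<And>bs. (\<Sum>b<l. h (bs @ [b])) = l * h bs"
    and c: "c > 0"
    and G: "\<And>bs. 0 \<le> G bs" "\<And>bs. h (bs @ [d]) + c * G bs \<le> h bs"
  shows "(\<lambda>n. word_avg l n (\<lambda>bs. (G bs)\<^sup>2)) \<longlonglongrightarrow> 0"
proof -
  have l0: "real l > 0" using l by simp
  define S where "S = (\<lambda>n. word_avg l n (\<lambda>bs. (h bs)\<^sup>2))"
  \<comment> \<open>The right side minus \<open>(h bs)\<^sup>2\<close> is the variance of the next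
    value, whose mean is \<open>h bs\<close>. The letter \<open>d\<close> alone, of probability
    \<open>1 / l\<close>, contributes at least the gain term.\<close>
  have step: "(h bs)\<^sup>2 + c\<^sup>2 / l * (G bs)\<^sup>2 \<le> (\<Sum>b<l. (h (bs @ [b]))\<^sup>2) / l" for bs
  proof -
    have "(c * G bs)\<^sup>2 \<le> (h bs - h (bs @ [d]))\<^sup>2"
      using G c by (intro power_mono) (auto simp: algebra_simps)
    also have "\<dots> = (h (bs @ [d]) - h bs)\<^sup>2" by (rule power2_commute)
    also have "\<dots> \<le> (\<Sum>b<l. (h (bs @ [b]) - h bs)\<^sup>2)"
      using l by (intro member_le_sum) auto
    also have "\<dots> = (\<Sum>b<l. (h (bs @ [b]))\<^sup>2) - 2 * h bs * (\<Sum>b<l. h (bs @ [b])) + l * (h bs)\<^sup>2"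
      by (simp add: power2_diff sum.distrib sum_subtractf sum_distrib_left mult_ac)
    also have "\<dots> = (\<Sum>b<l. (h (bs @ [b]))\<^sup>2) - l * (h bs)\<^sup>2"
      by (simp add: avg power2_eq_square)
    finally have "(l * (h bs)\<^sup>2 + (c * G bs)\<^sup>2) / l \<le> (\<Sum>b<l. (h (bs @ [b]))\<^sup>2) / l"
      by (intro divide_right_mono) auto
    then show ?thesis
      using l0 by (simp add: add_divide_distrib power_mult_distrib)
  qed
  have S_step: "S n + c\<^sup>2 / l * word_avg l n (\<lambda>bs. (G bs)\<^sup>2) \<le> S (Suc n)" for n
    unfolding S_def word_avg_Suc word_avg_mult[symmetric] word_avg_add[symmetric]
    by (intro word_avg_mono step)
  have nonneg: "0 \<le> word_avg l n (\<lambda>bs. (G bs)\<^sup>2)" for n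
    by (auto simp: word_avg_def intro!: divide_nonneg_nonneg sum_nonneg)
  have "incseq S"
  proof (rule incseq_SucI)
    fix n
    have "0 \<le> c\<^sup>2 / l * word_avg l n (\<lambda>bs. (G bs)\<^sup>2)"
      using nonneg by (intro mult_nonneg_nonneg) auto
    then show "S n \<le> S (Suc n)" using S_step[of n] by linarith
  qed
  moreover have "S n \<le> C\<^sup>2" for n
  proof -
    have "S n \<le> word_avg l n (\<lambda>_. C\<^sup>2)"
      unfolding S_def using h by (intro word_avg_mono power_mono)
    then show ?thesis using l by (simp add: word_avg_const)
  qed
  ultimately obtain L where "S \<longlonglongrightarrow> L"
    using incseq_convergent[of S "C\<^sup>2"] by blast
  then have "(\<lambda>n. S (Suc n) - S n) \<longlonglongrightarrow> L - L"
    by (intro tendsto_diff LIMSEQ_Suc)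
  then have "(\<lambda>n. S (Suc n) - S n) \<longlonglongrightarrow> 0" by simp
  then have lim: "(\<lambda>n. (S (Suc n) - S n) * (l / c\<^sup>2)) \<longlonglongrightarrow> 0"
    by (rule tendsto_mult_left_zero)
  show ?thesis
  proof (rule tendsto_sandwich[OF _ _ tendsto_const lim])
    show "\<forall>\<^sub>F n in sequentially. word_avg l n (\<lambda>bs. (G bs)\<^sup>2) \<le> (S (Suc n) - S n) * (l / c\<^sup>2)"
      using S_step c l0 by (simp add: field_simps add.commute)
  qed (simp add: nonneg)
qed

text \<open>Chebyshev's inequality with the second moment of \<open>G\<close>.\<close>

lemma word_avg_event_tendsto_0:
  assumes "(\<lambda>n. word_avg l n (\<lambda>bs. (G bs)\<^sup>2)) \<longlonglongrightarrow> 0" "\<epsilon> > 0"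
    and "\<And>bs. P bs \<Longrightarrow> \<epsilon> \<le> G bs"
  shows "(\<lambda>n. word_avg l n (\<lambda>bs. of_bool (P bs))) \<longlonglongrightarrow> 0"
proof (rule tendsto_sandwich[OF _ _ tendsto_const])
  have "of_bool (P bs) \<le> 1 / \<epsilon>\<^sup>2 * (G bs)\<^sup>2" for bs
    using assms(2) assms(3)[of bs] by (auto simp: divide_simps intro!: power_mono)
  then show "\<forall>\<^sub>F n in sequentially. word_avg l n (\<lambda>bs. of_bool (P bs)) \<le> 1 / \<epsilon>\<^sup>2 * word_avg l n (\<lambda>bs. (G bs)\<^sup>2)"
    by (simp add: word_avg_mono flip: word_avg_mult)
  show "(\<lambda>n. 1 / \<epsilon>\<^sup>2 * word_avg l n (\<lambda>bs. (G bs)\<^sup>2)) \<longlonglongrightarrow> 0"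
    using assms(1) by (rule tendsto_mult_right_zero)
qed (auto simp: word_avg_def intro!: always_eventually divide_nonneg_nonneg sum_nonneg)

text \<open>By independence each word of length \<open>n\<close> over \<open>{..<l}\<close> has
  probability \<open>1 / l ^ n\<close>. This is the only place where the probability space is looked
  into.\<close>

lemma (in prob_space) prob_uniform_process:
  assumes l: "l > 0"
    and indep: "indep_vars (\<lambda>_. count_space UNIV) B {1..}"
    and unif: "\<forall>k\<ge>1. distr M (count_space UNIV) (B k) = measure_pmf (pmf_of_set {..<l})"
  shows "prob {\<omega> \<in> space M. P (map (\<lambda>k. B k \<omega>) [1..<Suc n])} = word_avg l n (\<lambda>bs. of_bool (P bs))"
proof -
  define X where "X = (\<lambda>\<omega>. map (\<lambda>k. B k \<omega>) [1..<Suc n])"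
  have B: "B k \<in> measurable M (count_space UNIV)" if "k \<ge> 1" for k
    using indep that by (auto simp: indep_vars_def)
  have level: "{\<omega> \<in> space M. X \<omega> = bs} = {\<omega> \<in> space M. \<forall>k\<in>{1..n}. B k \<omega> = bs ! (k - 1)}"
    if "length bs = n" for bs
  proof -
    have "X \<omega> = bs \<longleftrightarrow> (\<forall>k\<in>{1..n}. B k \<omega> = bs ! (k - 1))" for \<omega>
    proof -
      have "X \<omega> = bs \<longleftrightarrow> (\<forall>k<n. B (Suc k) \<omega> = bs ! k)"
        using that by (simp add: X_def list_eq_iff_nth_eq del: upt_Suc)
      also have "\<dots> \<longleftrightarrow> (\<forall>k\<in>Suc ` {..<n}. B k \<omega> = bs ! (k - 1))" by auto
      also have "Suc ` {..<n} = {1..n}" by (simp add: image_Suc_lessThan)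
      finally show ?thesis .
    qed
    then show ?thesis by simp
  qed
  have events: "{\<omega> \<in> space M. X \<omega> = bs} \<in> events" for bs
  proof (cases "length bs = n")
    case True
    have "{\<omega> \<in> space M. B k \<omega> = bs ! (k - 1)} \<in> events" if "k \<in> {1..n}" for k
      using measurable_sets[OF B, of k "{bs ! (k - 1)}"] that
      by (simp add: vimage_def Int_def conj_commute)
    then show ?thesis
      unfolding level[OF True] by (intro sets.sets_Collect_finite_All) auto
  next
    case False
    then have "{\<omega> \<in> space M. X \<omega> = bs} = {}" by (auto simp: X_def)
    then show ?thesis by (simp only: sets.empty_sets)
  qed
  then have "(\<lambda>\<omega>. X \<omega>) \<in> measurable M (count_space UNIV)"
    by (subst measurable_count_space_eq2_countable) (auto simp: vimage_def Int_def conj_commute)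
  then have events_Collect: "{\<omega> \<in> space M. Q (X \<omega>)} \<in> events" for Q
    using measurable_sets[of X M "count_space UNIV" "Collect Q"]
    by (simp add: vimage_def Int_def conj_commute)
  have single: "prob {\<omega> \<in> space M. X \<omega> = bs} = 1 / real l ^ n" if bs: "bs \<in> words l n" for bs
  \<comment> \<open>The product rule for independent events takes a nonempty index set; the empty
    word is certain.\<close>
  proof (cases "n = 0")
    case True
    then show ?thesis using bs by (simp add: X_def words_def prob_space)
  next
    case False
    have len: "length bs = n" using bs by (simp add: words_def)
    have "{\<omega> \<in> space M. X \<omega> = bs} = (\<Inter>k\<in>{1..n}. B k -` {bs ! (k - 1)} \<inter> space M)"
      unfolding level[OF len] using False by auto
    also have "prob \<dots> = (\<Prod>k\<in>{1..n}. prob (B k -` {bs ! (k - 1)} \<inter> space M))"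
      using False by (intro indep_varsD[OF indep]) auto
    also have "\<dots> = (\<Prod>k\<in>{1..n}. 1 / real l)"
    proof (intro prod.cong refl)
      fix k assume k: "k \<in> {1..n}"
      then have "bs ! (k - 1) \<in> set bs"
        using len by (intro nth_mem) auto
      then have mem: "bs ! (k - 1) \<in> {..<l}"
        using bs by (auto simp: words_def)
      have "prob (B k -` {bs ! (k - 1)} \<inter> space M) = measure (distr M (count_space UNIV) (B k)) {bs ! (k - 1)}"
        using B[of k] k by (subst measure_distr) auto
      also have "\<dots> = pmf (pmf_of_set {..<l}) (bs ! (k - 1))"
        using unif k by (simp add: pmf.rep_eq)
      also have "\<dots> = 1 / real l"
        using mem l by (subst pmf_of_set) auto
      finally show "prob (B k -` {bs ! (k - 1)} \<inter> space M) = 1 / real l" .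
    qed
    also have "\<dots> = 1 / real l ^ n" by (simp add: power_one_over)
    finally show ?thesis .
  qed
  have union: "prob {\<omega> \<in> space M. X \<omega> \<in> A} = real (card A) / real l ^ n" if A: "A \<subseteq> words l n" for A
  proof -
    have fin: "finite A" using A finite_words finite_subset by blast
    have "{\<omega> \<in> space M. X \<omega> \<in> A} = (\<Union>bs\<in>A. {\<omega> \<in> space M. X \<omega> = bs})" by auto
    also have "prob \<dots> = (\<Sum>bs\<in>A. prob {\<omega> \<in> space M. X \<omega> = bs})"
      using fin events by (intro finite_measure_finite_Union) (auto simp: disjoint_family_on_def)
    also have "\<dots> = (\<Sum>bs\<in>A. 1 / real l ^ n)"
      using A by (intro sum.cong refl single) auto
    finally show ?thesis by simp
  qed
  \<comment> \<open>Single samples may leave \<open>{..<l}\<close>, but only on a null set, because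
    the words already carry all the mass.\<close>
  have "prob {\<omega> \<in> space M. X \<omega> \<in> words l n} = 1"
    using l by (subst union) (simp_all add: card_words)
  then have "AE \<omega> in M. X \<omega> \<in> words l n"
    by (auto dest: AE_prob_1)
  then have "prob {\<omega> \<in> space M. P (X \<omega>)} = prob {\<omega> \<in> space M. X \<omega> \<in> {bs \<in> words l n. P bs}}"
    by (intro finite_measure_eq_AE events_Collect) auto
  also have "\<dots> = word_avg l n (\<lambda>bs. of_bool (P bs))"
    by (subst union) (auto simp: word_avg_def sum.If_cases finite_words Int_def of_bool_def)
  finally show ?thesis by (simp only: X_def)
qed

section \<open>Parameters along a finite orbit\<close>

text \<open>If all products were below \<open>\<delta> ^ 3\<close>, a value above \<delta> would be
  followed by one above \<open>1 - \<delta>\<close>, which is again above \<delta>. One such value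
  thus lifts all later ones, by periodicity all values, and with them the average; without any such
  value the average is at most \<delta>.\<close>

lemma periodic_average_polarizes:
  fixes z :: "nat \<Rightarrow> real"
  assumes per: "\<And>k. z (k + p) = z k" "p > 0"
    and z: "\<And>k. z k \<le> 1"
    and N: "N > 0" and \<delta>: "0 < \<delta>" "\<delta> < 1 / 2"
    and mid: "(\<Sum>k<N. z k) / N \<in> {\<delta><..<1 - \<delta>}"
  obtains k where "\<delta> ^ 3 \<le> (z k)\<^sup>2 * (1 - z (Suc k))"
proof (rule ccontr)
  assume "\<not> thesis"
  with that have small: "(z k)\<^sup>2 * (1 - z (Suc k)) < \<delta> ^ 3" for k
    by (meson not_less)
  \<comment> \<open>Otherwise the product would be at least
    \<open>\<delta>\<^sup>2 * \<delta>\<close>; this is the origin of the cube.\<close>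
  have step: "1 - \<delta> < z (Suc k)" if "\<delta> < z k" for k
  proof (rule ccontr)
    assume "\<not> 1 - \<delta> < z (Suc k)"
    then have "\<delta>\<^sup>2 * \<delta> \<le> (z k)\<^sup>2 * (1 - z (Suc k))"
      using that \<delta> by (intro mult_mono power_mono) auto
    with small[of k] show False by (simp add: power3_eq_cube power2_eq_square)
  qed
  have "\<exists>k<N. \<delta> < z k"
  proof (rule ccontr)
    assume "\<not> ?thesis"
    then have "(\<Sum>k<N. z k) \<le> (\<Sum>k<N. \<delta>)" by (intro sum_mono) auto
    then show False using mid N by (simp add: field_simps)
  qed
  then obtain k where k: "\<delta> < z k" by blast
  have after: "1 - \<delta> < z (Suc (k + m))" for m
  proof (induction m)
    case 0
    show ?case using step[OF k] by simp
  next
    case (Suc m)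
    then have "\<delta> < z (Suc (k + m))" using \<delta> by simp
    then show ?case using step by simp
  qed
  have per': "z (m + i * p) = z m" for m i
    by (induction i) (simp_all add: per add.assoc[symmetric] add.commute[of p])
  have "1 - \<delta> < z m" for m
  proof -
    \<comment> \<open>\<open>Suc k\<close> periods, each of length at least 1, carry any index
      \<open>m\<close> beyond \<open>k\<close>.\<close>
    have "Suc k * 1 \<le> Suc k * p" using per(2) by (intro mult_le_mono2) simp
    then have "Suc k \<le> m + Suc k * p" by (simp only: mult_1_right trans_le_add2)
    then obtain r where "m + Suc k * p = Suc (k + r)"
      by (metis add_Suc le_Suc_ex)
    then show ?thesis using after[of r] per'[of m "Suc k"] by simp
  qed
  then have "(\<Sum>k<N. 1 - \<delta>) \<le> (\<Sum>k<N. z k)" by (intro sum_mono less_imp_le)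
  then show False using mid N by (simp add: field_simps)
qed

section \<open>Entropies of the iterates and the limit\<close>

lemma iterated_channel_snoc:
  "iterated_channel l g W (bs @ [b]) =
     (\<lambda>x. map_pmf (\<lambda>(ys, us). Block ys us) (channel_transform l g (iterated_channel l g W bs) b x))"
  by (simp add: iterated_channel_def)

lemma channel_entropy_iterated_snoc:
  "channel_entropy (iterated_channel l g W (bs @ [b])) =
     channel_entropy (channel_transform l g (iterated_channel l g W bs) b)"
  unfolding iterated_channel_snoc by (intro channel_entropy_map) (auto simp: inj_on_def)

theorem corollary5p11:
  fixes W :: "'x::finite \<Rightarrow> 'y::countable pmf"
    and g :: "'x list \<Rightarrow> 'x list"
    and l i j :: nat
    and u :: "'x list"
    and \<sigma> \<tau> :: "'x \<Rightarrow> 'x"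
    and M :: "'w measure"
    and B :: "nat \<Rightarrow> 'w \<Rightarrow> nat"
    and x x' :: 'x
    and \<delta> :: real
  assumes kernel: "bij_betw g {v. length v = l} {v. length v = l}"
    and u: "length u = l - 1"
    and ij: "i < l" "j < l" "i \<noteq> j"
    and perms: "bij \<sigma>" "bij \<tau>"
    and g_u: "\<forall>a. g (u @ [a]) ! i = \<sigma> a \<and> g (u @ [a]) ! j = \<tau> a"
    and g_v: "\<forall>v. length v = l - 1 \<and> v \<noteq> u \<longrightarrow>
      (\<exists>m<l. \<exists>\<mu>. bij \<mu> \<and> (\<forall>a. g (v @ [a]) ! m = \<mu> a))"
    and prob: "prob_space M"
    and B_indep: "prob_space.indep_vars M (\<lambda>_. count_space UNIV) B {1..}"
    and B_uniform: "\<forall>k\<ge>1. distr M (count_space UNIV) (B k) = measure_pmf (pmf_of_set {..<l})"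
    and \<delta>: "0 < \<delta>" "\<delta> < 1 / 2"
  shows "(\<lambda>n. measure M {\<omega> \<in> space M.
      bhattacharyya_perm (\<tau> \<circ> inv \<sigma>) (iterated_channel l g W (map (\<lambda>k. B k \<omega>) [1..<Suc n])) x x'
        \<in> {\<delta><..<1 - \<delta>}}) \<longlonglongrightarrow> 0"
proof -
  define \<rho> where "\<rho> = \<tau> \<circ> inv \<sigma>"
  define V where "V = iterated_channel l g W"
  define q where "q = real CARD('x)"
  define h where "h = (\<lambda>bs. enn2real (channel_entropy (V bs)))"
  define G2 where "G2 = (\<lambda>bs (a, b). (bhattacharyya (V bs) a b)\<^sup>2 * (1 - bhattacharyya (V bs) (\<rho> a) (\<rho> b)))"
  \<comment> \<open>Summing over all pairs lets one martingale estimate cover every point of the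
    orbit.\<close>
  define G where "G = (\<lambda>bs. \<Sum>z\<in>UNIV. G2 bs z)"
  \<comment> \<open>Averaging the gains over the \<open>q\<^sup>2\<close> pairs gives the additional
    factor \<open>1 / q\<^sup>2\<close>.\<close>
  define c where "c = 1 / (2 * q ^ l * q\<^sup>2)"
  have l: "l > 0" using ij by simp
  have q: "q > 0" by (simp add: q_def)
  have fin: "channel_entropy (V bs) < \<top>" for bs
    using channel_entropy_le_card[of "V bs"] by (rule order.strict_trans1) (simp add: of_nat_less_top)
  have eh: "ennreal (h bs) = channel_entropy (V bs)" for bs
    using fin by (simp add: h_def)
  have h0: "0 \<le> h bs" for bs by (simp add: h_def)
  have hq: "h bs \<le> q" for bs
    using channel_entropy_le_card[of "V bs"] unfolding eh[symmetric] q_def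
    by (simp add: ennreal_of_nat_eq_real_of_nat)
  have avg: "(\<Sum>b<l. h (bs @ [b])) = l * h bs" for bs
  proof -
    have "ennreal (\<Sum>b<l. h (bs @ [b])) = (\<Sum>b<l. channel_entropy (V (bs @ [b])))"
      by (simp add: eh h0 flip: sum_ennreal)
    also have "\<dots> = of_nat l * channel_entropy (V bs)"
      unfolding V_def channel_entropy_iterated_snoc by (rule channel_entropy_conservation[OF kernel])
    also have "\<dots> = ennreal (l * h bs)"
      by (simp add: eh h0 ennreal_mult ennreal_of_nat_eq_real_of_nat flip: eh)
    finally show ?thesis
      by (subst (asm) ennreal_inj) (auto intro!: sum_nonneg mult_nonneg_nonneg h0)
  qed
  have G20: "0 \<le> G2 bs z" for bs z
    by (cases z) (simp add: G2_def bhattacharyya_le_1)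
  have gain2: "h (bs @ [l - 1]) + G2 bs z / (2 * q ^ l) \<le> h bs" for bs z
  proof -
    obtain a b where z: "z = (a, b)" by (cases z)
    \<comment> \<open>The inputs \<open>inv \<sigma> a\<close> and \<open>inv \<sigma> b\<close>
      turn the pair under \<sigma> into \<open>(a, b)\<close> and the pair under \<tau> into
      \<open>(\<rho> a, \<rho> b)\<close>.\<close>
    have "\<sigma> (inv \<sigma> y) = y" for y
      using perms(1) by (simp add: bij_is_surj surj_f_inv_f)
    then have "ennreal (h (bs @ [l - 1])) + ennreal (G2 bs z / (2 * q ^ l)) \<le> ennreal (h bs)"
      using channel_entropy_gain[OF u ij perms(1) g_u g_v, of "V bs" "inv \<sigma> a" "inv \<sigma> b"]
      unfolding eh by (simp add: V_def channel_entropy_iterated_snoc G2_def z q_def \<rho>_def)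
    then show ?thesis
      using q h0 G20 by (simp flip: ennreal_plus)
  qed
  have gain: "h (bs @ [l - 1]) + c * G bs \<le> h bs" for bs
  proof -
    have "(\<Sum>z\<in>(UNIV :: ('x \<times> 'x) set). h (bs @ [l - 1]) + G2 bs z / (2 * q ^ l)) \<le> (\<Sum>z\<in>(UNIV :: ('x \<times> 'x) set). h bs)"
      by (intro sum_mono gain2)
    then have "q\<^sup>2 * h (bs @ [l - 1]) + G bs / (2 * q ^ l) \<le> q\<^sup>2 * h bs"
      by (simp add: sum.distrib G_def q_def power2_eq_square sum_divide_distrib)
    then have "(q\<^sup>2 * h (bs @ [l - 1]) + G bs / (2 * q ^ l)) / q\<^sup>2 \<le> h bs"
      using q by (simp add: divide_le_eq mult.commute)
    then show ?thesis
      using q by (simp add: add_divide_distrib c_def)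
  qed
  have "(\<lambda>n. word_avg l n (\<lambda>bs. (G bs)\<^sup>2)) \<longlonglongrightarrow> 0"
    using l q h0 hq avg G20 gain
    by (intro martingale_gain_tendsto_0[of "l - 1" l h q c G]) (auto simp: c_def G_def sum_nonneg)
  moreover have "\<delta> ^ 3 \<le> G bs" if mid: "bhattacharyya_perm \<rho> (V bs) x x' \<in> {\<delta><..<1 - \<delta>}" for bs
  proof -
    define z where "z = (\<lambda>k. bhattacharyya (V bs) ((\<rho> ^^ k) x) ((\<rho> ^^ k) x'))"
    \<comment> \<open>A permutation of a finite set has finite order, so the parameters along the
      orbit are periodic.\<close>
    have "permutation \<rho>"
      unfolding permutation using perms by (simp add: \<rho>_def bij_comp bij_imp_bij_inv)
    then obtain p where p: "\<rho> ^^ p = id" "p > 0"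
      by (rule permutation_is_nilpotent)
    have per: "z (k + p) = z k" for k
      by (simp add: z_def funpow_add p)
    have z1: "z k \<le> 1" for k
      by (simp add: z_def bhattacharyya_le_1)
    have "(\<Sum>k<fact CARD('x). z k) / real (fact CARD('x)) \<in> {\<delta><..<1 - \<delta>}"
      using mid by (simp add: bhattacharyya_perm_def z_def)
    then obtain k where "\<delta> ^ 3 \<le> (z k)\<^sup>2 * (1 - z (Suc k))"
      by (rule periodic_average_polarizes[where z = z, OF per p(2) z1 fact_gt_zero \<delta>])
    also have "\<dots> = G2 bs ((\<rho> ^^ k) x, (\<rho> ^^ k) x')"
      by (simp add: G2_def z_def)
    also have "\<dots> \<le> G bs"
      unfolding G_def by (intro member_le_sum G20) auto
    finally show ?thesis .
  qed
  ultimately have "(\<lambda>n. word_avg l n (\<lambda>bs. of_bool (bhattacharyya_perm \<rho> (V bs) x x' \<in> {\<delta><..<1 - \<delta>}))) \<longlonglongrightarrow> 0"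
    using \<delta>(1) by (intro word_avg_event_tendsto_0[of l G "\<delta> ^ 3"]) auto
  then show ?thesis
    by (simp only: V_def \<rho>_def prob_space.prob_uniform_process[OF prob l B_indep B_uniform,
          where P = "\<lambda>bs. bhattacharyya_perm (\<tau> \<circ> inv \<sigma>) (iterated_channel l g W bs) x x' \<in> {\<delta><..<1 - \<delta>}"])
qed

end
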